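(* Let $d \ge 2$ and $1 \le k \le d-1$ be integers, and let $f:\mathbb{R}^d \to \mathbb{R}$ be a nonnegative Lebesgue measurable function. Then there are no constants $m, M$ with $0 < m \le M < \infty$ for which $$m \le \int_P f \, d\mathcal{H}^k \le M \quad \text{for almost all affine } k\text{-planes } P \subseteq \mathbb{R}^d.$$
   Context: $\mathcal{H}^k$ denotes $k$-dimensional Hausdorff measure, normalized to agree with $k$-dimensional Lebesgue measure on $k$-planes. An affine $k$-plane in $\mathbb{R}^d$ is a translate of a $k$-dimensional linear subspace. "Almost all affine $k$-planes" refers to the rigid-motion-invariant measure on the affine Grassmannian of $k$-planes in $\mathbb{R}^d$; equivalently, with $E_0=\mathbb{R}^k\times\{0\}^{d-k}$, the planes $P = T(E_0) + y$ for almost every $T \in O(d)$ (Haar measure on the orthogonal group) and almost every $y \in T(E_0)^\perp$ ($(d-k)$-dimensional Lebesgue measure). No integrability or support condition is imposed on $f$. *)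

theory Defs
  imports "HOL-Analysis.Analysis"
begin

text \<open>
  Hausdorff measure. The factor \<open>unit_ball_vol k / 2 ^ k\<close> is the usual normalization: by the
  isodiametric inequality it makes the \<open>k\<close>-dimensional measure agree with \<open>k\<close>-dimensional
  Lebesgue measure on \<open>k\<close>-planes.
\<close>

text \<open>
  The library's \<^const>\<open>diameter\<close> is only meaningful for bounded sets, hence the boundedness
  condition on coverings. Empty covering sets count \<open>0\<close> also for \<open>k = 0\<close>, where the
  formula would give \<open>0 ^ 0 = 1\<close>.
\<close>

definition hausdorff_gauge :: "nat \<Rightarrow> 'a::metric_space set \<Rightarrow> ennreal" where
  "hausdorff_gauge k U =
     (if U = {} then 0 else ennreal (unit_ball_vol (real k) / 2 ^ k * diameter U ^ k))"

definition hausdorff_content :: "nat \<Rightarrow> real \<Rightarrow> 'a::metric_space set \<Rightarrow> ennreal" where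
  "hausdorff_content k \<delta> A =
     (INF U \<in> {U :: nat \<Rightarrow> 'a set. A \<subseteq> (\<Union>i. U i) \<and> (\<forall>i. bounded (U i) \<and> diameter (U i) \<le> \<delta>)}.
        \<Sum>i. hausdorff_gauge k (U i))"

definition hausdorff_outer :: "nat \<Rightarrow> 'a::metric_space set \<Rightarrow> ennreal" where
  "hausdorff_outer k A = (SUP \<delta> \<in> {0<..}. hausdorff_content k \<delta> A)"

text \<open>
  The sigma-algebra consists of all Caratheodory-measurable sets, so the measure is complete.
\<close>

definition hausdorff_measure :: "nat \<Rightarrow> 'a::metric_space measure" where
  "hausdorff_measure k =
     measure_of UNIV (lambda_system UNIV (Pow UNIV) (hausdorff_outer k)) (hausdorff_outer k)"

text \<open>
  Normalized Haar measure on the compact group \<open>O(d)\<close>, with \<open>d = CARD('n)\<close>: the (unique)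
  left-invariant Borel probability measure.
\<close>

definition orthogonal_haar :: "(real ^ 'n ^ 'n) measure \<Rightarrow> bool" where
  "orthogonal_haar \<mu> \<longleftrightarrow>
     sets \<mu> = sets (restrict_space borel {T. orthogonal_matrix T}) \<and>
     emeasure \<mu> (space \<mu>) = 1 \<and>
     (\<forall>S A. orthogonal_matrix S \<longrightarrow> A \<in> sets \<mu> \<longrightarrow> emeasure \<mu> ((\<lambda>T. S ** T) ` A) = emeasure \<mu> A)"

text \<open>
  The index type \<open>'n\<close> carries no order, so the plane spanned by the first \<open>k\<close> coordinate axes
  is rendered as the plane spanned by the axes in a set \<open>K\<close> of \<open>k\<close> indices.
\<close>

definition coord_plane :: "'n set \<Rightarrow> (real ^ 'n) set" where
  "coord_plane K = {x. \<forall>i. i \<notin> K \<longrightarrow> x $ i = 0}"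

text \<open>
  A property \<open>Q\<close> holds for almost all affine planes of dimension \<open>card K\<close>: it holds for the plane
  \<open>T E + y\<close>, where \<open>E = coord_plane K\<close>, for \<open>\<mu>\<close>-almost all \<open>T\<close> and almost all \<open>y\<close> in the
  orthogonal complement of \<open>T E\<close>. On that complement, a linear subspace of dimension
  \<open>CARD('n) - card K\<close>, Lebesgue measure is Hausdorff measure of that dimension.
\<close>

definition almost_all_affine_planes ::
    "(real ^ 'n ^ 'n) measure \<Rightarrow> 'n set \<Rightarrow> ((real ^ 'n) set \<Rightarrow> bool) \<Rightarrow> bool" where
  "almost_all_affine_planes \<mu> K Q \<longleftrightarrow>
     (AE T in \<mu>.
        AE y \<in> ((*v) T ` coord_plane K)\<^sup>\<bottom> in hausdorff_measure (CARD('n) - card K).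
          Q ((\<lambda>x. x + y) ` ((*v) T ` coord_plane K)))"

end

theory Submission
  imports Defs
begin

text \<open>
  Write \<open>E = coord_plane K\<close> and \<open>q = d - k\<close>. If almost all plane integrals lie in \<open>[m, M]\<close>, Fubini
  shows that for almost every rotation \<open>T\<close> the mass of \<open>f\<close> in the neighbourhood of \<open>T E\<close> of radius \<open>R\<close>
  is comparable to \<open>R ^ q\<close>. Averaging over \<open>T\<close> and dividing by \<open>R ^ q\<close>, the integral of
  \<open>f x * p (R / norm x) / R ^ q\<close> stays between two positive constants for all \<open>R\<close>, where \<open>p s\<close> is the
  probability that a fixed unit vector lies in the neighbourhood of \<open>T E\<close> of radius \<open>s\<close>. Since \<open>p s\<close> is comparable to
  \<open>s ^ q\<close> for small \<open>s\<close>, these integrands are, for \<open>R \<ge> 1\<close>, dominated by a multiple of the integrable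
  integrand for \<open>R = 1\<close>. They tend to \<open>0\<close> pointwise, so dominated convergence gives a contradiction.

  Only the comparability of Hausdorff and Lebesgue measure is used. Invariance under translations
  makes the product of the Hausdorff measures on \<open>E\<close> and its orthogonal complement a constant
  multiple of Lebesgue measure, and crude coverings show that the constant is neither \<open>0\<close> nor
  infinite; so the isodiametric inequality is not needed.
\<close>

subsection \<open>Hausdorff measure\<close>

text \<open>For a single rotation, slabs of different radii cannot be compared pointwise: a point
  outside the unit slab may lie in a large one. Averaging over rotations replaces the indicator of
  the slab by a weight that depends only on \<open>norm x / R\<close> and is positive at radius
  \<open>1\<close> for every \<open>x\<close>, so radii become comparable. Nothing is assumed about
  the integrability of \<open>f\<close>; it is the upper bound \<open>M\<close> that makes the
  weight at radius \<open>1\<close> integrable against \<open>f\<close>, while \<open>m\<close>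
  keeps the normalized integrals away from \<open>0\<close>. The power bounds for the weight come
  from integrating it over a shell, which gives the volume of the shell inside a slab; monotonicity
  in the norm turns this average into a pointwise bound. Both extremes of dimension show where the
  argument is tight. For \<open>k = 0\<close> the lower power bound fails, since a unit vector never
  lies in a small cube, and \<open>f = 1\<close> has integrals bounded on both sides. For
  \<open>q = 0\<close> nothing decays as \<open>R\<close> grows, and every \<open>f\<close> of
  positive finite integral satisfies such bounds.\<close>

lemma hausdorff_gauge_empty [simp]: "hausdorff_gauge k {} = 0"
  by (simp add: hausdorff_gauge_def)

lemma hausdorff_content_leI:
  assumes "A \<subseteq> (\<Union>i. U i)" "\<And>i. bounded (U i)" "\<And>i. diameter (U i) \<le> \<delta>"
  shows "hausdorff_content k \<delta> A \<le> (\<Sum>i. hausdorff_gauge k (U i))"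
  unfolding hausdorff_content_def by (rule INF_lower) (use assms in auto)

lemma hausdorff_content_geI:
  assumes "\<And>U. A \<subseteq> (\<Union>i. U i) \<Longrightarrow> (\<And>i. bounded (U i)) \<Longrightarrow> (\<And>i. diameter (U i) \<le> \<delta>)
      \<Longrightarrow> c \<le> (\<Sum>i. hausdorff_gauge k (U i))"
  shows "c \<le> hausdorff_content k \<delta> A"
  unfolding hausdorff_content_def by (rule INF_greatest) (use assms in auto)

lemma hausdorff_content_mono:
  assumes "A \<subseteq> B" "\<delta>' \<le> \<delta>"
  shows "hausdorff_content k \<delta> A \<le> hausdorff_content k \<delta>' B"
  by (rule hausdorff_content_geI, rule hausdorff_content_leI) (use assms in \<open>auto intro: order_trans\<close>)

lemma hausdorff_content_le_outer: "\<delta> > 0 \<Longrightarrow> hausdorff_content k \<delta> A \<le> hausdorff_outer k A"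
  unfolding hausdorff_outer_def by (rule SUP_upper) auto

lemma hausdorff_outer_leI:
  "(\<And>\<delta>. \<delta> > 0 \<Longrightarrow> hausdorff_content k \<delta> A \<le> c) \<Longrightarrow> hausdorff_outer k A \<le> c"
  unfolding hausdorff_outer_def by (rule SUP_least) auto

lemma hausdorff_outer_mono: "A \<subseteq> B \<Longrightarrow> hausdorff_outer k A \<le> hausdorff_outer k B"
  by (rule hausdorff_outer_leI)
     (meson hausdorff_content_mono hausdorff_content_le_outer order_refl order_trans)

lemma hausdorff_outer_empty [simp]: "hausdorff_outer k {} = 0"
proof -
  have "hausdorff_outer k {} \<le> 0"
  proof (rule hausdorff_outer_leI)
    fix \<delta> :: real assume "\<delta> > 0"
    then show "hausdorff_content k \<delta> {} \<le> 0"
      using hausdorff_content_leI[of "{}" "\<lambda>_. {}" \<delta> k] by simp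
  qed
  then show ?thesis by simp
qed

text \<open>Near-optimal covers with errors \<open>e / 2 ^ (n + 1)\<close> are merged along
  \<open>prod_decode\<close>. Each is chosen with the mesh \<open>\<delta>\<close> of the content to
  be bounded, but its gauge sum is compared with the outer measure, which does not depend on
  \<open>\<delta>\<close>.\<close>

lemma hausdorff_outer_UN_le:
  fixes A :: "nat \<Rightarrow> 'a::metric_space set"
  shows "hausdorff_outer k (\<Union>n. A n) \<le> (\<Sum>n. hausdorff_outer k (A n))"
proof (rule hausdorff_outer_leI, rule ennreal_le_epsilon)
  fix \<delta> e :: real
  assume "\<delta> > 0" "e > 0" and fin: "(\<Sum>n. hausdorff_outer k (A n)) < top"
  have "\<exists>U. A n \<subseteq> (\<Union>i. U i) \<and> (\<forall>i. bounded (U i) \<and> diameter (U i) \<le> \<delta>) \<and>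
      (\<Sum>i. hausdorff_gauge k (U i)) \<le> hausdorff_outer k (A n) + ennreal (e * (1/2) ^ Suc n)" for n
  proof -
    have "hausdorff_outer k (A n) < top"
      using fin by (metis ennreal_suminf_lessD)
    then have "hausdorff_content k \<delta> (A n) < top"
      using hausdorff_content_le_outer[OF \<open>\<delta> > 0\<close>, of k "A n"] by (simp add: le_less_trans)
    then have fin': "hausdorff_content k \<delta> (A n) \<noteq> \<infinity>" by simp
    have pos: "e * (1/2) ^ Suc n > 0" using \<open>e > 0\<close> by simp
    have "\<exists>U\<in>{U. A n \<subseteq> (\<Union>i. U i) \<and> (\<forall>i. bounded (U i) \<and> diameter (U i) \<le> \<delta>)}.
        (\<Sum>i. hausdorff_gauge k (U i)) < hausdorff_content k \<delta> (A n) + ennreal (e * (1/2) ^ Suc n)"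
      by (rule INF_approx_ennreal[OF pos _ fin']) (simp only: hausdorff_content_def)
    then obtain U where U: "A n \<subseteq> (\<Union>i. U i)" "\<forall>i. bounded (U i) \<and> diameter (U i) \<le> \<delta>"
      and "(\<Sum>i. hausdorff_gauge k (U i)) < hausdorff_content k \<delta> (A n) + ennreal (e * (1/2) ^ Suc n)"
      by blast
    note this(3)[THEN less_imp_le]
    also have "hausdorff_content k \<delta> (A n) + ennreal (e * (1/2) ^ Suc n)
        \<le> hausdorff_outer k (A n) + ennreal (e * (1/2) ^ Suc n)"
      by (intro add_right_mono hausdorff_content_le_outer \<open>\<delta> > 0\<close>)
    finally show ?thesis using U by blast
  qed
  then have "\<exists>U. \<forall>n. A n \<subseteq> (\<Union>i. U n i) \<and> (\<forall>i. bounded (U n i) \<and> diameter (U n i) \<le> \<delta>) \<and>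
      (\<Sum>i. hausdorff_gauge k (U n i)) \<le> hausdorff_outer k (A n) + ennreal (e * (1/2) ^ Suc n)"
    by (intro choice allI)
  then obtain U where U: "\<And>n. A n \<subseteq> (\<Union>i. U n i)" "\<And>n i. bounded (U n i)" "\<And>n i. diameter (U n i) \<le> \<delta>"
    "\<And>n. (\<Sum>i. hausdorff_gauge k (U n i)) \<le> hausdorff_outer k (A n) + ennreal (e * (1/2) ^ Suc n)"
    by blast
  have "hausdorff_content k \<delta> (\<Union>n. A n) \<le> (\<Sum>j. hausdorff_gauge k (case prod_decode j of (n, i) \<Rightarrow> U n i))"
  proof (rule hausdorff_content_leI)
    show "(\<Union>n. A n) \<subseteq> (\<Union>j. case prod_decode j of (n, i) \<Rightarrow> U n i)"
    proof
      fix x assume "x \<in> (\<Union>n. A n)"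
      then obtain n i where "x \<in> U n i" using U(1) by blast
      then have "x \<in> (case prod_decode (prod_encode (n, i)) of (n, i) \<Rightarrow> U n i)" by simp
      then show "x \<in> (\<Union>j. case prod_decode j of (n, i) \<Rightarrow> U n i)" by (rule UN_I[OF UNIV_I])
    qed
  qed (use U in \<open>auto split: prod.splits\<close>)
  also have "\<dots> = (\<Sum>n. \<Sum>i. hausdorff_gauge k (U n i))"
    using suminf_ennreal_2dimen[where f="\<lambda>(n, i). hausdorff_gauge k (U n i)"
        and g="\<lambda>n. \<Sum>i. hausdorff_gauge k (U n i)"]
    by (simp add: case_prod_unfold)
  also have "\<dots> \<le> (\<Sum>n. hausdorff_outer k (A n) + ennreal (e * (1/2) ^ Suc n))"
    by (intro suminf_le U) auto
  also have "\<dots> = (\<Sum>n. hausdorff_outer k (A n)) + (\<Sum>n. ennreal (e * (1/2) ^ Suc n))"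
    by (intro suminf_add[symmetric]) auto
  also have "(\<Sum>n. ennreal (e * (1/2) ^ Suc n)) = ennreal e"
  proof -
    have "(\<lambda>n. e * (1/2) ^ Suc n) sums (e * 1)"
      by (intro sums_mult power_half_series)
    then show ?thesis using \<open>e > 0\<close> by (intro suminf_ennreal_eq) auto
  qed
  finally show "hausdorff_content k \<delta> (\<Union>n. A n) \<le> (\<Sum>n. hausdorff_outer k (A n)) + ennreal e" .
qed

lemma outer_measure_space_hausdorff:
  "outer_measure_space (Pow UNIV) (hausdorff_outer k :: 'a::metric_space set \<Rightarrow> _)"
  unfolding outer_measure_space_def positive_def increasing_def countably_subadditive_def
  by (auto intro: hausdorff_outer_mono hausdorff_outer_UN_le)

lemma hausdorff_outer_Un_le:
  "hausdorff_outer k (A \<union> B) \<le> hausdorff_outer k A + hausdorff_outer k (B :: 'a::metric_space set)"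
proof -
  interpret sigma_algebra UNIV "Pow UNIV :: 'a set set" by (rule sigma_algebra_Pow)
  have "subadditive (Pow UNIV) (hausdorff_outer k :: 'a set \<Rightarrow> _)"
    using outer_measure_space_hausdorff
    unfolding outer_measure_space_def by (metis countably_subadditive_subadditive)
  moreover have "A \<union> B = A \<union> (B - A)" by auto
  ultimately have "hausdorff_outer k (A \<union> B) \<le> hausdorff_outer k A + hausdorff_outer k (B - A)"
    unfolding subadditive_def by (metis Diff_disjoint Pow_UNIV UNIV_I)
  also have "\<dots> \<le> hausdorff_outer k A + hausdorff_outer k B"
    by (intro add_left_mono hausdorff_outer_mono) auto
  finally show ?thesis .
qed

text \<open>No member of a cover finer than the gap \<open>e\<close> meets both sets, so the cover
  splits into one of \<open>A\<close> and one of \<open>B\<close> with no gauge counted twice.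
  Contents grow as the mesh shrinks, so a common mesh serves \<open>\<delta>1\<close> and
  \<open>\<delta>2\<close>.\<close>

lemma hausdorff_outer_separated_ge:
  fixes A B :: "'a::metric_space set"
  assumes "e > 0" and sep: "\<And>a b. a \<in> A \<Longrightarrow> b \<in> B \<Longrightarrow> e \<le> dist a b"
  shows "hausdorff_outer k A + hausdorff_outer k B \<le> hausdorff_outer k (A \<union> B)"
proof -
  have *: "hausdorff_content k \<delta>1 A + hausdorff_content k \<delta>2 B \<le> hausdorff_outer k (A \<union> B)"
    if "\<delta>1 > 0" "\<delta>2 > 0" for \<delta>1 \<delta>2
  proof -
    define \<delta> where "\<delta> = min (min \<delta>1 \<delta>2) (e/2)"
    have \<delta>: "\<delta> > 0" "\<delta> \<le> \<delta>1" "\<delta> \<le> \<delta>2" "\<delta> < e" using that \<open>e > 0\<close> by (auto simp: \<delta>_def min_def)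
    have "hausdorff_content k \<delta>1 A + hausdorff_content k \<delta>2 B \<le> hausdorff_content k \<delta> (A \<union> B)"
    proof (rule hausdorff_content_geI)
      fix U :: "nat \<Rightarrow> 'a set"
      assume U: "A \<union> B \<subseteq> (\<Union>i. U i)" "\<And>i. bounded (U i)" "\<And>i. diameter (U i) \<le> \<delta>"
      define UA where "UA i = (if U i \<inter> A = {} then {} else U i)" for i
      define UB where "UB i = (if U i \<inter> B = {} then {} else U i)" for i
      have "hausdorff_content k \<delta>1 A \<le> (\<Sum>i. hausdorff_gauge k (UA i))"
      proof (rule hausdorff_content_leI)
        show "A \<subseteq> (\<Union>i. UA i)" using U(1) unfolding UA_def by fastforce
        show "diameter (UA i) \<le> \<delta>1" for i
          using U(3)[of i] \<delta> that by (simp add: UA_def)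
      qed (use U in \<open>auto simp: UA_def\<close>)
      moreover have "hausdorff_content k \<delta>2 B \<le> (\<Sum>i. hausdorff_gauge k (UB i))"
      proof (rule hausdorff_content_leI)
        show "B \<subseteq> (\<Union>i. UB i)" using U(1) unfolding UB_def by fastforce
        show "diameter (UB i) \<le> \<delta>2" for i
          using U(3)[of i] \<delta> that by (simp add: UB_def)
      qed (use U in \<open>auto simp: UB_def\<close>)
      moreover have "hausdorff_gauge k (UA i) + hausdorff_gauge k (UB i) \<le> hausdorff_gauge k (U i)" for i
      proof -
        have False if "a \<in> U i" "a \<in> A" "b \<in> U i" "b \<in> B" for a b
          using sep[OF that(2,4)] diameter_bounded_bound[OF U(2) that(1,3)] U(3)[of i] \<delta>(4) by linarith
        then show ?thesis unfolding UA_def UB_def by fastforce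
      qed
      then have "(\<Sum>i. hausdorff_gauge k (UA i)) + (\<Sum>i. hausdorff_gauge k (UB i)) \<le> (\<Sum>i. hausdorff_gauge k (U i))"
        by (subst suminf_add) (auto intro!: suminf_le)
      ultimately show "hausdorff_content k \<delta>1 A + hausdorff_content k \<delta>2 B \<le> (\<Sum>i. hausdorff_gauge k (U i))"
        by (meson add_mono order_trans)
    qed
    then show ?thesis using hausdorff_content_le_outer[OF \<delta>(1)] by (rule order_trans)
  qed
  have "hausdorff_outer k A + hausdorff_content k \<delta>2 B \<le> hausdorff_outer k (A \<union> B)" if "\<delta>2 > 0" for \<delta>2
    unfolding hausdorff_outer_def[of k A]
    by (subst ennreal_SUP_add_left[symmetric]) (auto intro!: SUP_least * that)
  then show ?thesis
    unfolding hausdorff_outer_def[of k B]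
    by (subst add.commute, subst ennreal_SUP_add_left[symmetric])
       (auto intro!: SUP_least simp: add.commute[of _ "hausdorff_outer k A"])
qed

text \<open>Sets are added one at a time; the gap \<open>e n\<close> may shrink with
  \<open>n\<close>, because at each stage only the distance of the new set from the earlier ones
  matters.\<close>

lemma hausdorff_outer_sum_separated_le:
  fixes B :: "nat \<Rightarrow> 'a::metric_space set"
  assumes e: "\<And>n. e n > 0"
    and sep: "\<And>m n x y. m < n \<Longrightarrow> x \<in> B m \<Longrightarrow> y \<in> B n \<Longrightarrow> e n \<le> dist x y"
    and sub: "\<And>n. B n \<subseteq> A"
  shows "(\<Sum>n. hausdorff_outer k (B n)) \<le> hausdorff_outer k A"
proof (rule suminf_le_const)
  fix N
  have "(\<Sum>n<N. hausdorff_outer k (B n)) \<le> hausdorff_outer k (\<Union>n<N. B n)"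
  proof (induction N)
    case (Suc N)
    have "(\<Sum>n<Suc N. hausdorff_outer k (B n)) \<le> hausdorff_outer k (\<Union>n<N. B n) + hausdorff_outer k (B N)"
      using Suc by (simp add: add_right_mono)
    also have "\<dots> \<le> hausdorff_outer k ((\<Union>n<N. B n) \<union> B N)"
      by (rule hausdorff_outer_separated_ge[OF e[of N]]) (use sep in auto)
    also have "(\<Union>n<N. B n) \<union> B N = (\<Union>n<Suc N. B n)" by (auto simp: less_Suc_eq)
    finally show ?case .
  qed simp
  also have "\<dots> \<le> hausdorff_outer k A"
    by (rule hausdorff_outer_mono) (use sub in auto)
  finally show "(\<Sum>n<N. hausdorff_outer k (B n)) \<le> hausdorff_outer k A" .
qed auto

text \<open>Caratheodory's criterion for metric outer measures. The part \<open>D n\<close> of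
  \<open>A\<close> is separated from \<open>C\<close>; the points of \<open>A - C\<close> that it
  misses are sliced by distance into shells \<open>R i\<close>, and the tails of the shell sum
  vanish because the whole sum is at most twice the outer measure of \<open>A\<close>.\<close>

lemma closed_in_lambda_system_hausdorff:
  fixes C :: "'a::metric_space set"
  assumes "closed C"
  shows "C \<in> lambda_system UNIV (Pow UNIV) (hausdorff_outer k)"
proof -
  have *: "hausdorff_outer k (A \<inter> C) + hausdorff_outer k (A - C) \<le> hausdorff_outer k A" for A
  \<comment> \<open>\<open>infdist\<close> to the empty set is \<open>0\<close> by convention, so
    \<open>C = {}\<close> is treated apart; infinite outer measure makes the inequality
    trivial.\<close>
  proof (cases "C = {} \<or> hausdorff_outer k A = top")
    case False
    then have "C \<noteq> {}" and fin: "hausdorff_outer k A \<noteq> top" by auto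
    define D where "D n = {x \<in> A. 1 / real (n + 1) \<le> infdist x C}" for n
    define R where "R n = {x \<in> A. 1 / real (n + 2) \<le> infdist x C \<and> infdist x C < 1 / real (n + 1)}" for n
    have R_sub: "R n \<subseteq> A" for n by (auto simp: R_def)
    \<comment> \<open>Shells whose indices differ by at least two are separated by
      \<open>1 / n - 1 / (n + 1)\<close>, but adjacent shells may touch. This is why even and odd
      indices are summed separately.\<close>
    have R_dist: "1 / (real n + 1)\<^sup>2 \<le> dist x y"
      if "x \<in> R m" "y \<in> R n" "m + 2 \<le> n" for m n x y
    proof -
      have "1 / (real n + 1)\<^sup>2 \<le> 1 / real n - 1 / (real n + 1)"
      proof -
        have n: "real n > 0" using that by simp
        then have "1 / (real n + 1)\<^sup>2 \<le> 1 / (real n * (real n + 1))"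
          by (intro divide_left_mono) (auto simp: power2_eq_square intro!: mult_right_mono)
        also have "\<dots> = 1 / real n - 1 / (real n + 1)" using n by (simp add: field_simps)
        finally show ?thesis .
      qed
      also have "1 / real n \<le> 1 / real (m + 2)" using that by (intro divide_left_mono) auto
      also have "1 / real (m + 2) \<le> infdist x C" using that by (simp add: R_def)
      also have "infdist x C \<le> infdist y C + dist x y" by (rule infdist_triangle)
      also have "infdist y C \<le> 1 / (real n + 1)" using that by (simp add: R_def add.commute)
      finally show ?thesis by simp
    qed
    have half: "(\<Sum>i. hausdorff_outer k (R (2 * i + j))) \<le> hausdorff_outer k A" for j
      by (rule hausdorff_outer_sum_separated_le[where e="\<lambda>i. 1 / (real (2 * i + j) + 1)\<^sup>2"])
         (use R_sub R_dist in \<open>auto simp del: of_nat_add of_nat_mult\<close>)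
    have "(\<Sum>i. hausdorff_outer k (R i)) \<le> 2 * hausdorff_outer k A"
    proof -
      have "(\<Sum>i<n. hausdorff_outer k (R i)) \<le>
          (\<Sum>i<n. hausdorff_outer k (R (2 * i + 0))) + (\<Sum>i<n. hausdorff_outer k (R (2 * i + 1)))" for n
      proof -
        have "{..<n} \<subseteq> (\<lambda>i. 2 * i) ` {..<n} \<union> (\<lambda>i. 2 * i + 1) ` {..<n}"
        proof
          fix i assume "i \<in> {..<n}"
          then show "i \<in> (\<lambda>i. 2 * i) ` {..<n} \<union> (\<lambda>i. 2 * i + 1) ` {..<n}"
            by (cases "even i") (auto elim!: evenE oddE)
        qed
        then have "(\<Sum>i<n. hausdorff_outer k (R i)) \<le>
            (\<Sum>i\<in>(\<lambda>i. 2 * i) ` {..<n} \<union> (\<lambda>i. 2 * i + 1) ` {..<n}. hausdorff_outer k (R i))"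
          by (intro sum_mono2) auto
        also have "\<dots> = (\<Sum>i\<in>(\<lambda>i. 2 * i) ` {..<n}. hausdorff_outer k (R i))
            + (\<Sum>i\<in>(\<lambda>i. 2 * i + 1) ` {..<n}. hausdorff_outer k (R i))"
          by (intro sum.union_disjoint) (auto, presburger)
        finally show ?thesis by (simp add: sum.reindex inj_on_def)
      qed
      also have "(\<Sum>i<n. hausdorff_outer k (R (2 * i + 0))) + (\<Sum>i<n. hausdorff_outer k (R (2 * i + 1)))
          \<le> hausdorff_outer k A + hausdorff_outer k A" for n
        by (intro add_mono order_trans[OF sum_le_suminf half]) auto
      finally show ?thesis
        by (intro suminf_le_const) (auto simp: mult_2)
    qed
    then have sum_fin: "(\<Sum>i. hausdorff_outer k (R i)) \<noteq> top"
      using fin by (auto simp: top_unique ennreal_mult_eq_top_iff)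
    have D_eq: "A - C \<subseteq> D n \<union> (\<Union>i. R (i + n))" for n
    proof
      fix x assume x: "x \<in> A - C"
      then have pos: "infdist x C > 0"
        using \<open>closed C\<close> \<open>C \<noteq> {}\<close> by (metis DiffE in_closed_iff_infdist_zero infdist_nonneg less_eq_real_def)
      show "x \<in> D n \<union> (\<Union>i. R (i + n))"
      proof (cases "x \<in> D n")
        case False
        obtain N where N: "1 / real (N + 1) \<le> infdist x C"
          using pos by (metis Suc_eq_plus1 less_imp_le nat_approx_posE)
        \<comment> \<open>Minimality of \<open>m\<close> places the distance between
          \<open>1 / (m + 1)\<close> and \<open>1 / m\<close>, which is shell
          \<open>m - 1\<close>.\<close>
        define m where "m = (LEAST N. 1 / real (N + 1) \<le> infdist x C)"
        have m: "1 / real (m + 1) \<le> infdist x C" unfolding m_def using N by (rule LeastI)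
        have less: "infdist x C < 1 / real (j + 1)" if "j < m" for j
          using not_less_Least[of j "\<lambda>N. 1 / real (N + 1) \<le> infdist x C"] that by (simp add: m_def)
        have "n < m"
        proof (rule ccontr)
          assume "\<not> n < m"
          then have "1 / real (n + 1) \<le> 1 / real (m + 1)" by (intro divide_left_mono) auto
          then show False using False m x by (auto simp: D_def)
        qed
        then have "x \<in> R (m - 1)"
          using m less[of "m - 1"] x by (auto simp: R_def)
        moreover have "m - 1 = (m - 1 - n) + n" using \<open>n < m\<close> by simp
        ultimately show ?thesis by (metis UN_I UNIV_I UnI2)
      qed auto
    qed
    have step: "hausdorff_outer k (A \<inter> C) + hausdorff_outer k (A - C)
        \<le> hausdorff_outer k A + (\<Sum>i. hausdorff_outer k (R (i + n)))" for n
    proof -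
      have "hausdorff_outer k (A - C) \<le> hausdorff_outer k (D n) + hausdorff_outer k (\<Union>i. R (i + n))"
        using hausdorff_outer_mono[OF D_eq] hausdorff_outer_Un_le by (rule order_trans)
      also have "\<dots> \<le> hausdorff_outer k (D n) + (\<Sum>i. hausdorff_outer k (R (i + n)))"
        by (intro add_left_mono hausdorff_outer_UN_le)
      finally have "hausdorff_outer k (A \<inter> C) + hausdorff_outer k (A - C)
          \<le> (hausdorff_outer k (A \<inter> C) + hausdorff_outer k (D n)) + (\<Sum>i. hausdorff_outer k (R (i + n)))"
        by (simp add: add.assoc add_left_mono)
      also have "hausdorff_outer k (A \<inter> C) + hausdorff_outer k (D n) \<le> hausdorff_outer k (A \<inter> C \<union> D n)"
      proof (rule hausdorff_outer_separated_ge)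
        show "1 / real (n + 1) > 0" by simp
        show "1 / real (n + 1) \<le> dist a b" if "a \<in> A \<inter> C" "b \<in> D n" for a b
          using that infdist_le[of a C b] by (auto simp: D_def dist_commute)
      qed
      also have "\<dots> \<le> hausdorff_outer k A"
        by (rule hausdorff_outer_mono) (auto simp: D_def)
      finally show ?thesis by (simp add: add_right_mono)
    qed
    show ?thesis
    proof (rule ennreal_le_epsilon)
      fix e :: real assume "e > 0"
      let ?r = "\<lambda>i. hausdorff_outer k (R i)"
      have "(SUP n. \<Sum>i<n. ?r i) = suminf ?r" by (simp add: suminf_eq_SUP)
      then obtain n where n: "suminf ?r < (\<Sum>i<n. ?r i) + ennreal e"
        using SUP_approx_ennreal[OF \<open>e > 0\<close> UNIV_not_empty, of "suminf ?r" "\<lambda>n. \<Sum>i<n. ?r i"] sum_fin by auto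
      have "suminf ?r = (\<Sum>i. ?r (i + n)) + (\<Sum>i<n. ?r i)"
        by (rule suminf_offset) auto
      moreover have "(\<Sum>i<n. ?r i) \<noteq> top"
        by (rule neq_top_trans[OF sum_fin sum_le_suminf]) auto
      moreover have "(\<Sum>i<n. ?r i) + (\<Sum>i. ?r (i + n)) \<le> (\<Sum>i<n. ?r i) + ennreal e"
        using less_imp_le[OF n] calculation(1) by (simp add: add.commute)
      ultimately have "(\<Sum>i. ?r (i + n)) \<le> ennreal e"
        by (simp add: ennreal_add_left_cancel_le)
      then show "hausdorff_outer k (A \<inter> C) + hausdorff_outer k (A - C) \<le> hausdorff_outer k A + ennreal e"
        using step[of n] by (meson add_left_mono order_trans)
    qed
  qed (auto simp: top_unique)
  have "hausdorff_outer k (A \<inter> C) + hausdorff_outer k (A - C) = hausdorff_outer k A" for A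
    using *[of A] hausdorff_outer_Un_le[of k "A \<inter> C" "A - C"] by (simp add: Int_Diff_Un antisym)
  moreover have "C \<inter> A = A \<inter> C" "(UNIV - C) \<inter> A = A - C" for A by auto
  ultimately show ?thesis
    unfolding lambda_system_def by simp
qed

section \<open>The Hausdorff measure, its Borel sets and its null sets\<close>

lemma measure_space_hausdorff:
  "measure_space UNIV (lambda_system UNIV (Pow UNIV) (hausdorff_outer k))
     (hausdorff_outer k :: 'a::metric_space set \<Rightarrow> _)"
  by (rule sigma_algebra.caratheodory_lemma[OF sigma_algebra_Pow outer_measure_space_hausdorff])

lemma space_hausdorff_measure [simp]: "space (hausdorff_measure k) = UNIV"
  unfolding hausdorff_measure_def by (rule space_measure_of) auto

lemma sets_hausdorff_measure:
  "sets (hausdorff_measure k) = lambda_system UNIV (Pow UNIV) (hausdorff_outer k)"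
  unfolding hausdorff_measure_def
  by (rule sigma_algebra.sets_measure_of_eq) (use measure_space_hausdorff[of k] in \<open>unfold measure_space_def, blast\<close>)

lemma emeasure_hausdorff_measure:
  "A \<in> sets (hausdorff_measure k) \<Longrightarrow> emeasure (hausdorff_measure k) A = hausdorff_outer k A"
  unfolding sets_hausdorff_measure unfolding hausdorff_measure_def
  using measure_space_hausdorff[of k]
  by (intro emeasure_measure_of_sigma) (auto simp: measure_space_def)

lemma borel_subset_sets_hausdorff: "A \<in> sets borel \<Longrightarrow> A \<in> sets (hausdorff_measure k)"
proof -
  have "sets borel = sigma_sets UNIV (Collect closed :: 'a set set)"
    by (simp add: borel_eq_closed)
  also have "\<dots> \<subseteq> sets (hausdorff_measure k)"
    using closed_in_lambda_system_hausdorff[of _ k]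
    by (intro sets.sigma_sets_subset[of _ "hausdorff_measure k", simplified]) (auto simp: sets_hausdorff_measure)
  finally show "A \<in> sets borel \<Longrightarrow> A \<in> sets (hausdorff_measure k)" by auto
qed

lemma measurable_hausdorff_borel:
  "f \<in> borel_measurable borel \<Longrightarrow> f \<in> borel_measurable (hausdorff_measure k)"
  by (rule measurableI) (auto intro: borel_subset_sets_hausdorff simp: measurable_sets_borel)

text \<open>Sets of outer measure \<open>0\<close> satisfy the Caratheodory condition, so
  almost-everywhere statements about arbitrary predicates reduce to the outer measure. The condition
  on planes in the theorem is a predicate not known to be measurable.\<close>

lemma AE_hausdorff_iff:
  "(AE x in hausdorff_measure k. P x) \<longleftrightarrow> hausdorff_outer k {x. \<not> P x} = 0"
proof
  assume "AE x in hausdorff_measure k. P x"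
  then obtain N where "{x. \<not> P x} \<subseteq> N" "N \<in> sets (hausdorff_measure k)" "emeasure (hausdorff_measure k) N = 0"
    by (auto elim!: AE_E)
  then show "hausdorff_outer k {x. \<not> P x} = 0"
    using hausdorff_outer_mono[of "{x. \<not> P x}" N k] by (simp add: emeasure_hausdorff_measure)
next
  assume 0: "hausdorff_outer k {x. \<not> P x} = 0"
  have "{x. \<not> P x} \<in> sets (hausdorff_measure k)"
    unfolding sets_hausdorff_measure lambda_system_def
  proof (clarsimp, rule antisym)
    fix A
    have "hausdorff_outer k ({x. \<not> P x} \<inter> A) = 0"
      using hausdorff_outer_mono[of "{x. \<not> P x} \<inter> A" "{x. \<not> P x}" k] 0 by simp
    then show "hausdorff_outer k ({x. \<not> P x} \<inter> A) + hausdorff_outer k ((UNIV - {x. \<not> P x}) \<inter> A) \<le> hausdorff_outer k A"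
      by (auto intro: hausdorff_outer_mono)
    show "hausdorff_outer k A \<le> hausdorff_outer k ({x. \<not> P x} \<inter> A) + hausdorff_outer k ((UNIV - {x. \<not> P x}) \<inter> A)"
      by (rule order_trans[OF hausdorff_outer_mono hausdorff_outer_Un_le]) auto
  qed
  with 0 show "AE x in hausdorff_measure k. P x"
    by (intro AE_I[of _ _ "{x. \<not> P x}"]) (auto simp: emeasure_hausdorff_measure)
qed

section \<open>Invariance of Hausdorff measure under isometries\<close>

lemma diameter_isometric_image:
  assumes "\<And>x y. dist (f x) (f y) = dist x y"
  shows "diameter (f ` U) = diameter U"
proof -
  have "f ` U \<times> f ` U = map_prod f f ` (U \<times> U)" by auto
  then have "(\<lambda>(x, y). dist x y) ` (f ` U \<times> f ` U) = (\<lambda>(x, y). dist x y) ` (U \<times> U)"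
    by (simp add: image_image case_prod_unfold assms)
  then show ?thesis by (simp add: diameter_def)
qed

lemma bounded_isometric_image:
  assumes "\<And>x y. dist (f x) (f y) = dist x y" "bounded U"
  shows "bounded (f ` U)"
  using assms(2) unfolding bounded_two_points by (auto simp: assms(1))

lemma hausdorff_outer_isometric_image_le:
  fixes f :: "'a::metric_space \<Rightarrow> 'b::metric_space"
  assumes "\<And>x y. dist (f x) (f y) = dist x y"
  shows "hausdorff_outer k (f ` A) \<le> hausdorff_outer k A"
proof (rule hausdorff_outer_leI)
  fix \<delta> :: real assume "\<delta> > 0"
  have "hausdorff_content k \<delta> (f ` A) \<le> hausdorff_content k \<delta> A"
  proof (rule hausdorff_content_geI)
    fix U :: "nat \<Rightarrow> 'a set"
    assume U: "A \<subseteq> (\<Union>i. U i)" "\<And>i. bounded (U i)" "\<And>i. diameter (U i) \<le> \<delta>"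
    have "hausdorff_content k \<delta> (f ` A) \<le> (\<Sum>i. hausdorff_gauge k (f ` U i))"
      by (rule hausdorff_content_leI)
         (use U in \<open>auto simp: diameter_isometric_image assms bounded_isometric_image simp flip: image_UN\<close>)
    moreover have "hausdorff_gauge k (f ` U i) = hausdorff_gauge k (U i)" for i
      unfolding hausdorff_gauge_def diameter_isometric_image[OF assms] by simp
    ultimately show "hausdorff_content k \<delta> (f ` A) \<le> (\<Sum>i. hausdorff_gauge k (U i))" by simp
  qed
  then show "hausdorff_content k \<delta> (f ` A) \<le> hausdorff_outer k A"
    using hausdorff_content_le_outer[OF \<open>\<delta> > 0\<close>] by (rule order_trans)
qed

lemma hausdorff_outer_isometric_image:
  fixes f :: "'a::metric_space \<Rightarrow> 'b::metric_space"
  assumes f: "\<And>x y. dist (f x) (f y) = dist x y" and "surj f"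
  shows "hausdorff_outer k (f ` A) = hausdorff_outer k A"
proof (rule antisym[OF hausdorff_outer_isometric_image_le[OF f]])
  have inj: "inj f" by (rule injI) (metis f dist_eq_0_iff)
  have "dist (inv f x) (inv f y) = dist x y" for x y
    by (metis f \<open>surj f\<close> surj_f_inv_f)
  then have "hausdorff_outer k (inv f ` f ` A) \<le> hausdorff_outer k (f ` A)"
    by (rule hausdorff_outer_isometric_image_le)
  then show "hausdorff_outer k A \<le> hausdorff_outer k (f ` A)"
    by (simp add: inj)
qed

lemma isometric_continuous_on:
  fixes f :: "'a::metric_space \<Rightarrow> 'b::metric_space"
  assumes "\<And>x y. dist (f x) (f y) = dist x y"
  shows "continuous_on S f"
  using assms unfolding continuous_on_iff by auto

lemma distr_hausdorff_isometry:
  fixes f :: "'a::metric_space \<Rightarrow> 'a"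
  assumes f: "\<And>x y. dist (f x) (f y) = dist x y" and "surj f"
  shows "distr (hausdorff_measure k) borel f = distr (hausdorff_measure k) borel (\<lambda>x. x)"
proof (rule measure_eqI)
  fix A assume "A \<in> sets (distr (hausdorff_measure k) borel f)"
  then have A: "A \<in> sets borel" by simp
  have meas: "f \<in> borel_measurable borel"
    by (rule borel_measurable_continuous_onI[OF isometric_continuous_on[OF f]])
  have "f -` A \<in> sets borel" using measurable_sets_borel[OF meas A] by simp
  then show "emeasure (distr (hausdorff_measure k) borel f) A = emeasure (distr (hausdorff_measure k) borel (\<lambda>x. x)) A"
    using A meas hausdorff_outer_isometric_image[OF f \<open>surj f\<close>, of k "f -` A"] \<open>surj f\<close>
    by (simp add: emeasure_distr measurable_hausdorff_borel emeasure_hausdorff_measure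
        borel_subset_sets_hausdorff surj_image_vimage_eq del: image_vimage_eq)
qed simp

lemma nn_integral_hausdorff_isometry:
  fixes f :: "'a::metric_space \<Rightarrow> 'a"
  assumes f: "\<And>x y. dist (f x) (f y) = dist x y" and "surj f" and g: "g \<in> borel_measurable borel"
  shows "(\<integral>\<^sup>+x. g (f x) \<partial>hausdorff_measure k) = (\<integral>\<^sup>+x. g x \<partial>hausdorff_measure k)"
proof -
  have "f \<in> borel_measurable borel"
    by (rule borel_measurable_continuous_onI[OF isometric_continuous_on[OF f]])
  then show ?thesis
    using nn_integral_distr[of f "hausdorff_measure k" borel g] nn_integral_distr[of "\<lambda>x. x" "hausdorff_measure k" borel g]
    by (simp add: distr_hausdorff_isometry[OF f \<open>surj f\<close>] g measurable_hausdorff_borel)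
qed

lemma AE_hausdorff_isometry:
  fixes f :: "'a::metric_space \<Rightarrow> 'a"
  assumes f: "\<And>x y. dist (f x) (f y) = dist x y" and "surj f"
  shows "(AE x in hausdorff_measure k. P (f x)) \<longleftrightarrow> (AE x in hausdorff_measure k. P x)"
proof -
  have "f ` {x. \<not> P (f x)} = {x. \<not> P x}"
    by (auto simp: image_iff) (metis \<open>surj f\<close> surj_f_inv_f)
  then show ?thesis
    using hausdorff_outer_isometric_image[OF f \<open>surj f\<close>, of k "{x. \<not> P (f x)}"] by (simp add: AE_hausdorff_iff)
qed

subsection \<open>Hausdorff measure of cubes in coordinate planes\<close>

abbreviation cube :: "real \<Rightarrow> (real ^ 'n) set" where
  "cube R \<equiv> {x. \<forall>i. \<bar>x $ i\<bar> \<le> R}"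

lemma emeasure_lborel_cbox_cart:
  fixes a b :: "real ^ 'n"
  assumes "\<And>i. a $ i \<le> b $ i"
  shows "emeasure lborel (cbox a b) = ennreal (\<Prod>i\<in>UNIV. b $ i - a $ i)"
proof -
  have "cbox a b \<noteq> {}" using assms by (simp add: interval_ne_empty_cart)
  moreover have "emeasure lborel (cbox a b) = ennreal (measure lborel (cbox a b))"
    using emeasure_lborel_cbox_finite[of a b] by (intro emeasure_eq_ennreal_measure) simp
  ultimately show ?thesis by (simp add: content_cbox_cart)
qed

lemma prod_split_const:
  fixes a b :: real and K :: "'n::finite set"
  shows "(\<Prod>i\<in>UNIV. if i \<in> K then a else b) = a ^ card K * b ^ card (- K)"
proof -
  have "(\<Prod>i\<in>UNIV. if i \<in> K then a else b) = (\<Prod>i\<in>UNIV \<inter> K. a) * (\<Prod>i\<in>UNIV \<inter> - K. b)"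
    by (subst prod.If_cases) auto
  then show ?thesis by simp
qed

lemma emeasure_lborel_box_split:
  fixes a :: "real ^ 'n"
  assumes "0 \<le> r" "0 \<le> s"
  shows "emeasure lborel {x. \<forall>i. \<bar>x $ i - a $ i\<bar> \<le> (if i \<in> K then r else s)}
     = ennreal ((2 * r) ^ card K * (2 * s) ^ card (- K))"
proof -
  let ?w = "\<chi> i. if i \<in> K then r else s"
  have "{x. \<forall>i. \<bar>x $ i - a $ i\<bar> \<le> (if i \<in> K then r else s)} = cbox (a - ?w) (a + ?w)"
    by (auto simp: mem_box_cart abs_le_iff algebra_simps) (smt (verit))+
  also have "emeasure lborel \<dots> = ennreal (\<Prod>i\<in>UNIV. if i \<in> K then 2 * r else 2 * s)"
    using assms by (subst emeasure_lborel_cbox_cart) (auto intro!: arg_cong[where f=ennreal] prod.cong)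
  finally show ?thesis by (simp add: prod_split_const)
qed

lemma emeasure_lborel_cube:
  assumes "0 \<le> R"
  shows "emeasure lborel (cube R :: (real ^ 'n) set) = ennreal ((2 * R) ^ CARD('n))"
  using emeasure_lborel_box_split[of R R "0 :: real ^ 'n" UNIV] assms by simp

lemma card_Compl_finite: "card K + card (- K) = CARD('n)" for K :: "'n::finite set"
  using card_Un_disjoint[of K "- K"] by simp

lemma closed_coord_plane: "closed (coord_plane K)"
proof -
  have "coord_plane K = (\<Inter>i\<in>-K. {x. x $ i = 0})" by (auto simp: coord_plane_def)
  then show ?thesis by (auto intro!: closed_INT closed_Collect_eq continuous_intros)
qed

lemma borel_coord_plane [measurable]: "coord_plane K \<in> sets borel"
  by (rule borel_closed[OF closed_coord_plane])

lemma closed_cube: "closed (cube R :: (real ^ 'n) set)"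
  by (intro closed_Collect_all closed_Collect_le continuous_intros)

lemma borel_cube [measurable]: "cube R \<in> sets borel"
  by (rule borel_closed[OF closed_cube])

text \<open>Each covering set is thickened to a box with side twice its diameter along
  \<open>K\<close> and side \<open>2 * R\<close> across. These boxes cover the full-dimensional
  cube, so subadditivity of Lebesgue measure bounds the gauge sum from below, whatever the
  mesh.\<close>

lemma hausdorff_outer_coord_plane_cube_ge:
  fixes K :: "'n::finite set"
  assumes "card K = k" "R > 0"
  shows "ennreal (unit_ball_vol (real k) / 2 ^ k * R ^ k) \<le> hausdorff_outer k (coord_plane K \<inter> cube R)"
proof -
  define c where "c = unit_ball_vol (real k) / 2 ^ k"
  have "c > 0" by (simp add: c_def)
  define q where "q = card (- K)"
  have "ennreal (c * R ^ k) \<le> hausdorff_content k 1 (coord_plane K \<inter> cube R)"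
  proof (rule hausdorff_content_geI)
    fix U :: "nat \<Rightarrow> (real ^ 'n) set"
    assume U: "coord_plane K \<inter> cube R \<subseteq> (\<Union>i. U i)" "\<And>i. bounded (U i)"
    define a where "a i = (SOME x. x \<in> U i)" for i
    have a: "a i \<in> U i" if "x \<in> U i" for x i using that by (auto simp: a_def intro: someI)
    define B where "B i = (if U i = {} then {} else
        {x. \<forall>j. \<bar>x $ j - (\<chi> j. if j \<in> K then a i $ j else 0) $ j\<bar> \<le> (if j \<in> K then diameter (U i) else R)})" for i
    \<comment> \<open>The ratio of the volume of a thickened box to the gauge of the set that it
      comes from.\<close>
    define D where "D = 2 ^ k * (2 * R) ^ q / c"
    have "D > 0" using \<open>R > 0\<close> \<open>c > 0\<close> by (simp add: D_def)
    have diam0: "diameter (U i) \<ge> 0" for i using U(2) by (rule diameter_ge_0)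
    have B_meas: "B i \<in> sets borel" for i
      unfolding B_def by auto
    have B_le: "emeasure lborel (B i) = ennreal D * hausdorff_gauge k (U i)" for i
    proof (cases "U i = {}")
      case False
      then have "emeasure lborel (B i) = ennreal ((2 * diameter (U i)) ^ k * (2 * R) ^ q)"
        unfolding B_def q_def assms(1)[symmetric] if_not_P[OF False]
        using \<open>R > 0\<close> by (intro emeasure_lborel_box_split diam0) auto
      also have "(2 * diameter (U i)) ^ k * (2 * R) ^ q = D * (c * diameter (U i) ^ k)"
        using \<open>c > 0\<close> by (simp add: D_def power_mult_distrib)
      also have "ennreal \<dots> = ennreal D * hausdorff_gauge k (U i)"
        using False \<open>c > 0\<close> \<open>D > 0\<close> diam0[of i] by (subst ennreal_mult) (auto simp: hausdorff_gauge_def c_def)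
      finally show ?thesis .
    qed (simp add: B_def)
    have "cube R \<subseteq> (\<Union>i. B i)"
    proof
      fix x :: "real ^ 'n" assume x: "x \<in> cube R"
      let ?p = "\<chi> j. if j \<in> K then x $ j else 0"
      have "?p \<in> coord_plane K \<inter> cube R" using x \<open>R > 0\<close> by (auto simp: coord_plane_def)
      then obtain i where i: "?p \<in> U i" using U(1) by blast
      have "\<bar>x $ j - a i $ j\<bar> \<le> diameter (U i)" if "j \<in> K" for j
      proof -
        have "\<bar>x $ j - a i $ j\<bar> = \<bar>(?p - a i) $ j\<bar>" using that by simp
        also have "\<dots> \<le> dist ?p (a i)" unfolding dist_norm by (rule component_le_norm_cart)
        also have "\<dots> \<le> diameter (U i)" by (rule diameter_bounded_bound[OF U(2) i a[OF i]])
        finally show ?thesis .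
      qed
      then have "x \<in> B i" using i x by (auto simp: B_def)
      then show "x \<in> (\<Union>i. B i)" by blast
    qed
    then have "emeasure lborel (cube R :: (real ^ 'n) set) \<le> emeasure lborel (\<Union>i. B i)"
      using B_meas by (intro emeasure_mono) auto
    also have "\<dots> \<le> (\<Sum>i. emeasure lborel (B i))"
      using B_meas by (intro emeasure_subadditive_countably) auto
    also have "\<dots> = ennreal D * (\<Sum>i. hausdorff_gauge k (U i))" by (simp add: B_le)
    also have "emeasure lborel (cube R :: (real ^ 'n) set) = ennreal ((2 * R) ^ (k + q))"
      using \<open>R > 0\<close> card_Compl_finite[of K] assms(1) by (simp add: emeasure_lborel_cube q_def)
    also have "(2 * R) ^ (k + q) = D * (c * R ^ k)"
      using \<open>c > 0\<close> by (simp add: D_def power_mult_distrib power_add)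
    also have "ennreal \<dots> = ennreal D * ennreal (c * R ^ k)"
      using \<open>c > 0\<close> \<open>D > 0\<close> \<open>R > 0\<close> by (subst ennreal_mult) auto
    finally show "ennreal (c * R ^ k) \<le> (\<Sum>i. hausdorff_gauge k (U i))"
      using \<open>D > 0\<close> by (subst (asm) ennreal_mult_le_mult_iff) auto
  qed
  also have "\<dots> \<le> hausdorff_outer k (coord_plane K \<inter> cube R)"
    by (rule hausdorff_content_le_outer) simp
  finally show ?thesis by (simp add: c_def)
qed

lemma hausdorff_content_finite_cover:
  fixes V :: "'b \<Rightarrow> 'a::metric_space set"
  assumes "finite S" "A \<subseteq> (\<Union>s\<in>S. V s)" "\<delta> \<ge> 0"
    and "\<And>s. s \<in> S \<Longrightarrow> bounded (V s)" "\<And>s. s \<in> S \<Longrightarrow> diameter (V s) \<le> \<delta>"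
  shows "hausdorff_content k \<delta> A \<le> (\<Sum>s\<in>S. hausdorff_gauge k (V s))"
proof -
  obtain h where h: "bij_betw h {0..<card S} S" using ex_bij_betw_nat_finite[OF assms(1)] by blast
  \<comment> \<open>The finite family is padded with empty sets to a sequence; their gauge is
    \<open>0\<close> also for \<open>k = 0\<close>.\<close>
  define U where "U i = (if i < card S then V (h i) else {})" for i
  have hS: "h i \<in> S" if "i < card S" for i using h that by (auto simp: bij_betw_def)
  have "hausdorff_content k \<delta> A \<le> (\<Sum>i. hausdorff_gauge k (U i))"
  proof (rule hausdorff_content_leI)
    show "A \<subseteq> (\<Union>i. U i)"
    proof
      fix x assume "x \<in> A"
      then obtain s where "s \<in> S" "x \<in> V s" using assms(2) by blast
      moreover obtain i where "i < card S" "s = h i"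
        using h \<open>s \<in> S\<close> by (metis atLeastLessThan_iff bij_betw_iff_bijections)
      ultimately have "x \<in> U i" by (simp add: U_def)
      then show "x \<in> (\<Union>i. U i)" by blast
    qed
  qed (use assms hS in \<open>auto simp: U_def\<close>)
  also have "\<dots> = (\<Sum>i\<in>{0..<card S}. hausdorff_gauge k (U i))"
    by (rule suminf_finite) (auto simp: U_def)
  also have "\<dots> = (\<Sum>i\<in>{0..<card S}. hausdorff_gauge k (V (h i)))"
    by (rule sum.cong) (auto simp: U_def)
  also have "\<dots> = (\<Sum>s\<in>S. hausdorff_gauge k (V s))"
    by (rule sum.reindex_bij_betw[OF h])
  finally show ?thesis .
qed

lemma diameter_le_sum_components:
  fixes U :: "(real ^ 'n) set"
  assumes "\<And>x y i. x \<in> U \<Longrightarrow> y \<in> U \<Longrightarrow> \<bar>x $ i - y $ i\<bar> \<le> r" "r \<ge> 0"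
  shows "bounded U" "diameter U \<le> real CARD('n) * r"
proof -
  have *: "dist x y \<le> real CARD('n) * r" if "x \<in> U" "y \<in> U" for x y
  proof -
    have "dist x y \<le> (\<Sum>i\<in>UNIV. \<bar>(x - y) $ i\<bar>)" unfolding dist_norm by (rule norm_le_l1_cart)
    also have "\<dots> \<le> (\<Sum>i\<in>(UNIV :: 'n set). r)" using assms that by (intro sum_mono) auto
    finally show ?thesis by simp
  qed
  then show "bounded U" unfolding bounded_two_points by blast
  show "diameter U \<le> real CARD('n) * r"
    by (rule diameter_le) (use * assms(2) in \<open>auto simp: dist_norm\<close>)
qed

text \<open>A grid of \<open>N ^ k\<close> cells of side \<open>2 * R / N\<close> covers the cube.
  Bounding the Euclidean norm by the sum norm gives each cell diameter at most
  \<open>d * (2 * R / N)\<close>, and \<open>N\<close> cancels in the resulting gauge sum, so the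
  bound is uniform in the mesh.\<close>

lemma hausdorff_outer_coord_plane_cube_finite:
  fixes K :: "'n::finite set"
  assumes K: "card K = k" and "R > 0"
  shows "hausdorff_outer k (coord_plane K \<inter> cube R) < \<infinity>"
proof -
  define c where "c = unit_ball_vol (real k) / 2 ^ k"
  have "c > 0" by (simp add: c_def)
  define d where "d = real CARD('n)"
  have "d > 0" by (simp add: d_def)
  have "hausdorff_outer k (coord_plane K \<inter> cube R) \<le> ennreal (c * (d * (2 * R)) ^ k)"
  proof (rule hausdorff_outer_leI)
    fix \<delta> :: real assume "\<delta> > 0"
    obtain N0 :: nat where N0: "d * (2 * R) / \<delta> < real N0" using reals_Archimedean2 by blast
    define N where "N = Suc N0"
    have N: "N > 0" "d * (2 * R / real N) \<le> \<delta>"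
      using N0 \<open>\<delta> > 0\<close> \<open>R > 0\<close> \<open>d > 0\<close> by (auto simp: N_def field_simps) 
    define S where "S = K \<rightarrow>\<^sub>E {..<N}"
    have "finite S" unfolding S_def by (intro finite_PiE) auto
    have cardS: "card S = N ^ k" by (simp add: S_def card_PiE K)
    define V where "V g = {x \<in> coord_plane K. \<forall>j\<in>K. real (g j) * (2 * R / real N) - R \<le> x $ j \<and>
        x $ j \<le> (real (g j) + 1) * (2 * R / real N) - R}" for g :: "'n \<Rightarrow> nat"
    have V_diff: "\<bar>x $ j - y $ j\<bar> \<le> 2 * R / real N" if "x \<in> V g" "y \<in> V g" for x y j g
    proof (cases "j \<in> K")
      case True
      have "(real (g j) + 1) * (2 * R / real N) = real (g j) * (2 * R / real N) + 2 * R / real N"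
        by (simp add: ring_distribs add_divide_distrib)
      then show ?thesis using that True unfolding V_def mem_Collect_eq abs_le_iff
        by (smt (verit))
    next
      case False
      then show ?thesis using that \<open>R > 0\<close> by (auto simp: V_def coord_plane_def)
    qed
    have V: "bounded (V g)" "diameter (V g) \<le> d * (2 * R / real N)" for g
      using diameter_le_sum_components[of "V g" "2 * R / real N"] V_diff[of _ g] \<open>R > 0\<close> by (auto simp: d_def)
    have "hausdorff_content k \<delta> (coord_plane K \<inter> cube R) \<le> (\<Sum>g\<in>S. hausdorff_gauge k (V g))"
    proof (rule hausdorff_content_finite_cover[OF \<open>finite S\<close>])
      show "coord_plane K \<inter> cube R \<subseteq> (\<Union>g\<in>S. V g)"
      proof
        fix x assume x: "x \<in> coord_plane K \<inter> cube R"
        have "\<exists>m<N. real m * (2 * R / real N) - R \<le> x $ j \<and> x $ j \<le> (real m + 1) * (2 * R / real N) - R" for j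
        proof -
          define t where "t = (x $ j + R) * real N / (2 * R)"
          have xj: "- R \<le> x $ j" "x $ j \<le> R" using x by (auto simp: abs_le_iff) (smt (verit))
          have "(x $ j + R) * real N \<le> (2 * R) * real N"
            using xj by (intro mult_right_mono) auto
          then have t: "0 \<le> t" "t \<le> real N"
            using xj \<open>R > 0\<close> by (auto simp: t_def pos_divide_le_eq mult.commute)
          have x_t: "x $ j = t * (2 * R / real N) - R"
            using N(1) \<open>R > 0\<close> by (simp add: t_def field_simps)
          have "\<exists>m<N. real m \<le> t \<and> t \<le> real m + 1"
          \<comment> \<open>The right endpoint belongs to the last closed cell, of index
            \<open>N - 1\<close>, whereas the floor would give \<open>N\<close>.\<close>
          proof (cases "t = real N")
            case True
            then show ?thesis using N(1) by (intro exI[of _ "N - 1"]) auto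
          next
            case False
            have "real (nat \<lfloor>t\<rfloor>) \<le> t" "t \<le> real (nat \<lfloor>t\<rfloor>) + 1"
              using t(1) by linarith+
            then show ?thesis using t False by (intro exI[of _ "nat \<lfloor>t\<rfloor>"]) linarith
          qed
          then obtain m where "m < N" "real m \<le> t" "t \<le> real m + 1" by blast
          moreover have "2 * R / real N \<ge> 0" using \<open>R > 0\<close> by simp
          ultimately show ?thesis
            unfolding x_t by (intro exI[of _ m] conjI diff_right_mono mult_right_mono) auto
        qed
        then have "\<exists>g. \<forall>j. g j < N \<and> real (g j) * (2 * R / real N) - R \<le> x $ j \<and>
            x $ j \<le> (real (g j) + 1) * (2 * R / real N) - R"
          by (intro choice allI)
        then obtain g where g: "\<And>j. g j < N" "\<And>j. real (g j) * (2 * R / real N) - R \<le> x $ j \<and>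
            x $ j \<le> (real (g j) + 1) * (2 * R / real N) - R"
          by blast
        then have "restrict g K \<in> S" "x \<in> V (restrict g K)"
          using x by (auto simp: S_def V_def)
        then show "x \<in> (\<Union>g\<in>S. V g)" by blast
      qed
    qed (use V N(2) \<open>\<delta> > 0\<close> in \<open>auto intro: order_trans\<close>)
    also have "\<dots> \<le> (\<Sum>g\<in>S. ennreal (c * (d * (2 * R / real N)) ^ k))"
    proof (rule sum_mono)
      fix g
      have "c * diameter (V g) ^ k \<le> c * (d * (2 * R / real N)) ^ k"
        using V \<open>c > 0\<close> by (intro mult_left_mono power_mono diameter_ge_0) auto
      then show "hausdorff_gauge k (V g) \<le> ennreal (c * (d * (2 * R / real N)) ^ k)"
        unfolding hausdorff_gauge_def c_def[symmetric] by (auto intro: ennreal_leI)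
    qed
    also have "\<dots> = ennreal (real (N ^ k) * (c * (d * (2 * R / real N)) ^ k))"
      using \<open>c > 0\<close> \<open>d > 0\<close> \<open>R > 0\<close> by (simp add: cardS ennreal_mult ennreal_of_nat_eq_real_of_nat)
    also have "real (N ^ k) * (c * (d * (2 * R / real N)) ^ k) = c * (d * (2 * R)) ^ k"
      using N(1) by (simp add: power_mult_distrib power_divide)
    finally show "hausdorff_content k \<delta> (coord_plane K \<inter> cube R) \<le> ennreal (c * (d * (2 * R)) ^ k)" .
  qed
  also have "\<dots> < \<infinity>" by simp
  finally show ?thesis .
qed

subsection \<open>Disintegration of Lebesgue measure over parallel planes\<close>

text \<open>The Fubini proof that an invariant measure is unique: the integral of
  \<open>indicator A x * indicator B (y - x)\<close> is evaluated once by shifting \<open>y\<close>,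
  and once by shifting \<open>x\<close> and then, after a further exchange, \<open>y\<close>. The
  product form avoids division by possibly infinite values; symmetry of \<open>B\<close> absorbs the
  reflection \<open>- x\<close> produced by the substitution.\<close>

lemma translation_invariant_measure_unique:
  fixes \<nu> :: "'a::euclidean_space measure"
  assumes [measurable_cong, simp]: "sets \<nu> = sets borel" and "sigma_finite_measure \<nu>"
    and inv: "\<And>g a. g \<in> borel_measurable borel \<Longrightarrow> (\<integral>\<^sup>+x. g (x + a) \<partial>\<nu>) = (\<integral>\<^sup>+x. g x \<partial>\<nu>)"
    and [measurable]: "A \<in> sets borel" "B \<in> sets borel"
    and sym: "\<And>x. - x \<in> B \<longleftrightarrow> x \<in> B"
  shows "emeasure \<nu> A * emeasure lborel B = emeasure lborel A * emeasure \<nu> B"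
proof -
  interpret \<nu>: sigma_finite_measure \<nu> by fact
  interpret pair_sigma_finite \<nu> "lborel :: 'a measure" ..
  have lborel_inv: "(\<integral>\<^sup>+y. g (a + y) \<partial>lborel) = (\<integral>\<^sup>+y. g y \<partial>lborel)" if "g \<in> borel_measurable borel" for g and a :: 'a
    using nn_integral_distr[of "(+) a" lborel borel g] that by (simp add: lborel_distr_plus)
  have "emeasure \<nu> A * emeasure lborel B = (\<integral>\<^sup>+x. indicator A x * emeasure lborel B \<partial>\<nu>)"
    by (subst nn_integral_multc) auto
  also have "\<dots> = (\<integral>\<^sup>+x. \<integral>\<^sup>+y. indicator A x * indicator B (- x + y) \<partial>lborel \<partial>\<nu>)"
  proof (rule nn_integral_cong)
    fix x :: 'a
    show "indicator A x * emeasure lborel B = (\<integral>\<^sup>+y. indicator A x * indicator B (- x + y) \<partial>lborel)"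
      by (subst nn_integral_cmult, measurable) (subst lborel_inv[of "indicator B" "- x"], auto)
  qed
  also have "\<dots> = (\<integral>\<^sup>+y. \<integral>\<^sup>+x. indicator A x * indicator B (- x + y) \<partial>\<nu> \<partial>lborel)"
    by (rule Fubini'[symmetric]) measurable
  also have "\<dots> = (\<integral>\<^sup>+y. \<integral>\<^sup>+x. indicator A (x + y) * indicator B (- x) \<partial>\<nu> \<partial>lborel)"
  proof (rule nn_integral_cong)
    fix y :: 'a
    show "(\<integral>\<^sup>+x. indicator A x * indicator B (- x + y) \<partial>\<nu>) = (\<integral>\<^sup>+x. indicator A (x + y) * indicator B (- x) \<partial>\<nu>)"
      using inv[of "\<lambda>x. indicator A x * indicator B (- x + y)" y] by simp
  qed
  also have "\<dots> = (\<integral>\<^sup>+x. \<integral>\<^sup>+y. indicator A (x + y) * indicator B (- x) \<partial>lborel \<partial>\<nu>)"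
    by (rule Fubini') measurable
  also have "\<dots> = (\<integral>\<^sup>+x. emeasure lborel A * indicator B x \<partial>\<nu>)"
  proof (rule nn_integral_cong)
    fix x :: 'a
    have "indicator B (- x) = (indicator B x :: ennreal)" by (simp add: indicator_def sym)
    then show "(\<integral>\<^sup>+y. indicator A (x + y) * indicator B (- x) \<partial>lborel) = emeasure lborel A * indicator B x"
      by (subst nn_integral_multc, measurable) (subst lborel_inv[of "indicator A" x], auto)
  qed
  also have "\<dots> = emeasure lborel A * emeasure \<nu> B"
    by (subst nn_integral_cmult) auto
  finally show ?thesis .
qed

text \<open>A density keeps the measure on the ambient space while concentrating it on
  \<open>E\<close>, so sums of vectors from two planes and isometries of the whole space can be used
  without changing the underlying space.\<close>

definition plane_measure :: "nat \<Rightarrow> 'a::metric_space set \<Rightarrow> 'a measure" where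
  "plane_measure k E = density (hausdorff_measure k) (indicator E)"

lemma space_plane_measure [simp]: "space (plane_measure k E) = UNIV"
  by (simp add: plane_measure_def)

lemma sets_plane_measure [measurable_cong, simp]: "sets (plane_measure k E) = sets (hausdorff_measure k)"
  by (simp add: plane_measure_def)

lemma measurable_plane_borel:
  "f \<in> borel_measurable borel \<Longrightarrow> f \<in> borel_measurable (plane_measure k E)"
  unfolding measurable_cong_sets[OF sets_plane_measure refl] by (rule measurable_hausdorff_borel)

lemma indicator_measurable_hausdorff:
  "E \<in> sets borel \<Longrightarrow> (indicator E :: _ \<Rightarrow> ennreal) \<in> borel_measurable (hausdorff_measure k)"
  by (intro measurable_hausdorff_borel borel_measurable_indicator)

lemma emeasure_plane_measure:
  assumes E: "E \<in> sets borel" and A: "A \<in> sets borel"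
  shows "emeasure (plane_measure k E) A = hausdorff_outer k (A \<inter> E)"
proof -
  have "emeasure (plane_measure k E) A = (\<integral>\<^sup>+x. indicator E x * indicator A x \<partial>hausdorff_measure k)"
    unfolding plane_measure_def
    by (rule emeasure_density[OF indicator_measurable_hausdorff[OF E] borel_subset_sets_hausdorff[OF A]])
  also have "\<dots> = (\<integral>\<^sup>+x. indicator (A \<inter> E) x \<partial>hausdorff_measure k)"
    by (simp add: indicator_inter_arith mult.commute)
  also have "\<dots> = hausdorff_outer k (A \<inter> E)"
    using borel_subset_sets_hausdorff[OF sets.Int[OF A E], of k] by (simp add: emeasure_hausdorff_measure)
  finally show ?thesis .
qed

lemma nn_integral_plane_measure:
  assumes "E \<in> sets borel" "g \<in> borel_measurable borel"
  shows "(\<integral>\<^sup>+x. g x \<partial>plane_measure k E) = (\<integral>\<^sup>+x. indicator E x * g x \<partial>hausdorff_measure k)"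
  unfolding plane_measure_def
  by (rule nn_integral_density[OF indicator_measurable_hausdorff[OF assms(1)] measurable_hausdorff_borel[OF assms(2)]])

lemma AE_plane_measure:
  assumes "E \<in> sets borel"
  shows "(AE x in plane_measure k E. P x) \<longleftrightarrow> (AE x in hausdorff_measure k. x \<in> E \<longrightarrow> P x)"
  unfolding plane_measure_def AE_density[OF indicator_measurable_hausdorff[OF assms]]
  by (simp add: indicator_def)

lemma sigma_finite_measure_cubeI:
  fixes M :: "(real ^ 'n) measure"
  assumes "space M = UNIV" "\<And>R. cube R \<in> sets M" "\<And>R. R > 0 \<Longrightarrow> emeasure M (cube R) \<noteq> \<infinity>"
  shows "sigma_finite_measure M"
proof
  let ?A = "range (\<lambda>n. cube (real (Suc n)) :: (real ^ 'n) set)"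
  have "x \<in> \<Union>?A" for x :: "real ^ 'n"
  proof -
    obtain n where n: "norm x < real n" using reals_Archimedean2 by blast
    have "\<bar>x $ i\<bar> \<le> real (Suc n)" for i
      using component_le_norm_cart[of x i] n by simp
    then have "x \<in> cube (real (Suc n))" by simp
    then show ?thesis by (rule UN_I[OF UNIV_I])
  qed
  then have "\<Union>?A = space M" using assms(1) by (simp only:) (rule UNIV_eq_I[symmetric])
  moreover have "emeasure M a \<noteq> \<infinity>" if a: "a \<in> ?A" for a
  proof -
    obtain n where "a = cube (real (Suc n))" using a by (rule imageE)
    then show ?thesis using assms(3)[of "real (Suc n)"] by simp
  qed
  moreover have "?A \<subseteq> sets M" by (rule image_subsetI) (rule assms(2))
  moreover have "countable ?A" by simp
  ultimately show "\<exists>A. countable A \<and> A \<subseteq> sets M \<and> \<Union>A = space M \<and> (\<forall>a\<in>A. emeasure M a \<noteq> \<infinity>)"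
    by (intro exI[of _ ?A] conjI ballI)
qed

lemma cube_coord_plane_measure:
  fixes K :: "'n::finite set"
  assumes "R > 0"
  shows "ennreal (unit_ball_vol (real (card K)) / 2 ^ card K * R ^ card K)
      \<le> emeasure (plane_measure (card K) (coord_plane K)) (cube R)"
    and "emeasure (plane_measure (card K) (coord_plane K)) (cube R) < \<infinity>"
    and "0 < emeasure (plane_measure (card K) (coord_plane K)) (cube R)"
proof -
  have eq: "emeasure (plane_measure (card K) (coord_plane K)) (cube R)
      = hausdorff_outer (card K) (coord_plane K \<inter> cube R)"
    by (subst emeasure_plane_measure) (auto simp: Int_commute)
  show *: "ennreal (unit_ball_vol (real (card K)) / 2 ^ card K * R ^ card K)
      \<le> emeasure (plane_measure (card K) (coord_plane K)) (cube R)"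
    unfolding eq by (rule hausdorff_outer_coord_plane_cube_ge[OF refl assms])
  show "emeasure (plane_measure (card K) (coord_plane K)) (cube R) < \<infinity>"
    unfolding eq by (rule hausdorff_outer_coord_plane_cube_finite[OF refl assms])
  have "0 < unit_ball_vol (real (card K)) / 2 ^ card K * R ^ card K"
    using assms by simp
  then show "0 < emeasure (plane_measure (card K) (coord_plane K)) (cube R)"
    using less_le_trans[OF _ *] by (simp add: ennreal_less_zero_iff)
qed

text \<open>Below full dimension \<open>hausdorff_measure\<close> on the whole space is not
  sigma-finite; concentrating it on a plane is what makes Fubini available.\<close>

lemma sigma_finite_coord_plane_measure:
  "sigma_finite_measure (plane_measure (card K) (coord_plane K))"
proof (rule sigma_finite_measure_cubeI)
  show "emeasure (plane_measure (card K) (coord_plane K)) (cube R) \<noteq> \<infinity>" if "R > 0" for R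
    using cube_coord_plane_measure(2)[OF that, of K] by simp
qed (auto intro: borel_subset_sets_hausdorff)

lemma nn_integral_plane_measure_translate:
  fixes K :: "'n::finite set"
  assumes "a \<in> coord_plane K" and g: "g \<in> borel_measurable borel"
  shows "(\<integral>\<^sup>+x. g (x + a) \<partial>plane_measure k (coord_plane K)) = (\<integral>\<^sup>+x. g x \<partial>plane_measure k (coord_plane K))"
proof -
  note g [measurable]
  have shift: "x + a \<in> coord_plane K \<longleftrightarrow> x \<in> coord_plane K" for x
    using assms(1) by (simp add: coord_plane_def)
  have "(\<integral>\<^sup>+x. g (x + a) \<partial>plane_measure k (coord_plane K))
      = (\<integral>\<^sup>+x. indicator (coord_plane K) x * g (x + a) \<partial>hausdorff_measure k)"
    by (rule nn_integral_plane_measure) measurable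
  also have "\<dots> = (\<integral>\<^sup>+x. indicator (coord_plane K) (x + a) * g (x + a) \<partial>hausdorff_measure k)"
    by (simp only: indicator_def shift)
  also have "\<dots> = (\<integral>\<^sup>+x. indicator (coord_plane K) x * g x \<partial>hausdorff_measure k)"
  proof (rule nn_integral_hausdorff_isometry)
    show "surj (\<lambda>x. x + a)" by (rule surjI[where f="\<lambda>x. x - a"]) simp
  qed simp_all
  also have "\<dots> = (\<integral>\<^sup>+x. g x \<partial>plane_measure k (coord_plane K))"
    by (rule nn_integral_plane_measure[symmetric]) measurable
  finally show ?thesis .
qed

text \<open>The product measure is pushed forward under addition to \<open>\<nu>\<close>. A
  translation by \<open>a\<close> splits into its components \<open>b\<close> and \<open>c\<close>
  in the two planes, which shift the inner and the outer integral respectively, so the uniqueness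
  lemma applies to \<open>\<nu>\<close>. The constant is read off from
  \<open>cube 1\<close>.\<close>

lemma lborel_coord_plane_disintegration:
  fixes K :: "'n::finite set"
  obtains C where "0 < C" "C < \<infinity>"
    "\<And>g :: real ^ 'n \<Rightarrow> ennreal. g \<in> borel_measurable borel \<Longrightarrow>
      (\<integral>\<^sup>+y. (\<integral>\<^sup>+x. g (x + y) \<partial>plane_measure (card K) (coord_plane K))
         \<partial>plane_measure (card (- K)) (coord_plane (- K))) = C * (\<integral>\<^sup>+x. g x \<partial>lborel)"
proof -
  let ?E = "coord_plane K" and ?F = "coord_plane (- K)"
  define NE where "NE = plane_measure (card K) ?E"
  define NF where "NF = plane_measure (card (- K)) ?F"
  interpret NE: sigma_finite_measure NE unfolding NE_def by (rule sigma_finite_coord_plane_measure)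
  interpret NF: sigma_finite_measure NF unfolding NF_def by (rule sigma_finite_coord_plane_measure)
  interpret pair_sigma_finite NF NE ..
  \<comment> \<open>The sigma-algebras of \<open>NE\<close> and \<open>NF\<close> contain the Borel
    sets without being equal to \<open>sets borel\<close> by definition; viewing the identity as a
    map into \<open>borel\<close> makes Borel functions of \<open>x + y\<close> measurable on the
    product.\<close>
  have id_E: "(\<lambda>x. x) \<in> borel_measurable NE" and id_F: "(\<lambda>x. x) \<in> borel_measurable NF"
    unfolding NE_def NF_def by (auto intro: measurable_plane_borel)
  have cube_sets [measurable, simp]: "cube R \<in> sets NE" "cube R \<in> sets NF" for R
    unfolding NE_def NF_def by (auto intro: borel_subset_sets_hausdorff)
  have fst_m [measurable]: "fst \<in> borel_measurable (NF \<Otimes>\<^sub>M NE)" and snd_m [measurable]: "snd \<in> borel_measurable (NF \<Otimes>\<^sub>M NE)"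
    using measurable_compose[OF measurable_fst id_F] measurable_compose[OF measurable_snd id_E] by auto
  have snd_m' [measurable]: "snd \<in> borel_measurable ((borel :: (real ^ 'n) measure) \<Otimes>\<^sub>M NE)"
    by (rule measurable_compose[OF measurable_snd id_E])
  define \<nu> where "\<nu> = distr (NF \<Otimes>\<^sub>M NE) borel (\<lambda>p. snd p + fst p)"
  have sets_\<nu> [measurable_cong, simp]: "sets \<nu> = sets borel" by (simp add: \<nu>_def)
  have int: "(\<integral>\<^sup>+z. g z \<partial>\<nu>) = (\<integral>\<^sup>+y. \<integral>\<^sup>+x. g (x + y) \<partial>NE \<partial>NF)" if [measurable]: "g \<in> borel_measurable borel" for g
  proof -
    have "(\<integral>\<^sup>+z. g z \<partial>\<nu>) = (\<integral>\<^sup>+p. g (snd p + fst p) \<partial>(NF \<Otimes>\<^sub>M NE))"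
      unfolding \<nu>_def by (rule nn_integral_distr) measurable
    also have "\<dots> = (\<integral>\<^sup>+y. \<integral>\<^sup>+x. g (x + y) \<partial>NE \<partial>NF)"
      by (subst NE.nn_integral_fst[symmetric]) auto
    finally show ?thesis .
  qed
  have \<nu>_inv: "(\<integral>\<^sup>+z. g (z + a) \<partial>\<nu>) = (\<integral>\<^sup>+z. g z \<partial>\<nu>)" if [measurable]: "g \<in> borel_measurable borel" for g a
  proof -
    define b where "b = (\<chi> i. if i \<in> K then a $ i else 0)"
    define c where "c = (\<chi> i. if i \<in> K then 0 else a $ i)"
    have abc: "a = b + c" "b \<in> ?E" "c \<in> ?F" by (auto simp: b_def c_def vec_eq_iff coord_plane_def)
    define G where "G y = (\<integral>\<^sup>+x. g (x + y) \<partial>NE)" for y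
    have G [measurable]: "G \<in> borel_measurable borel"
      unfolding G_def by (rule NE.borel_measurable_nn_integral) (simp add: case_prod_unfold)
    have "(\<integral>\<^sup>+z. g (z + a) \<partial>\<nu>) = (\<integral>\<^sup>+y. \<integral>\<^sup>+x. g (x + y + a) \<partial>NE \<partial>NF)"
      by (subst int) auto
    also have "\<dots> = (\<integral>\<^sup>+y. G (y + c) \<partial>NF)"
    proof (rule nn_integral_cong)
      fix y
      have "(\<integral>\<^sup>+x. g (x + y + a) \<partial>NE) = (\<integral>\<^sup>+x. g ((x + b) + (y + c)) \<partial>NE)"
        by (simp add: abc(1) algebra_simps)
      also have "\<dots> = G (y + c)"
        unfolding G_def NE_def
        by (rule nn_integral_plane_measure_translate[OF abc(2), where g="\<lambda>x. g (x + (y + c))"]) measurable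
      finally show "(\<integral>\<^sup>+x. g (x + y + a) \<partial>NE) = G (y + c)" .
    qed
    also have "\<dots> = (\<integral>\<^sup>+y. G y \<partial>NF)"
      unfolding NF_def by (rule nn_integral_plane_measure_translate[OF abc(3) G])
    also have "\<dots> = (\<integral>\<^sup>+z. g z \<partial>\<nu>)"
      by (simp add: int G_def)
    finally show ?thesis .
  qed
  \<comment> \<open>The summands are supported on complementary coordinates, so in the maximum norm
    \<open>x + y\<close> lies in a cube exactly when both \<open>x\<close> and \<open>y\<close>
    do.\<close>
  have prod_eq: "emeasure \<nu> (cube R) = emeasure NF (cube R) * emeasure NE (cube R)" for R
  proof -
    have "emeasure \<nu> (cube R) = (\<integral>\<^sup>+z. indicator (cube R) z \<partial>\<nu>)" by simp
    also have "\<dots> = (\<integral>\<^sup>+y. \<integral>\<^sup>+x. indicator (cube R) (x + y) \<partial>NE \<partial>NF)" by (rule int) simp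
    also have "\<dots> = (\<integral>\<^sup>+y. \<integral>\<^sup>+x. indicator (cube R) y * indicator (cube R) x \<partial>NE \<partial>NF)"
    proof -
      have *: "indicator (cube R) (x + y) = (indicator (cube R) y * indicator (cube R) x :: ennreal)" 
        if "x \<in> ?E" "y \<in> ?F" for x y
      proof -
        have "\<bar>(x + y) $ i\<bar> \<le> R \<longleftrightarrow> \<bar>x $ i\<bar> \<le> R \<and> \<bar>y $ i\<bar> \<le> R" for i
        proof (cases "i \<in> K")
          case True
          then have "y $ i = 0" using that by (simp add: coord_plane_def)
          then show ?thesis by auto
        next
          case False
          then have "x $ i = 0" using that by (simp add: coord_plane_def)
          then show ?thesis by auto
        qed
        then show ?thesis by (auto simp: indicator_def)
      qed
      have AE_E: "AE x in NE. x \<in> ?E" and AE_F: "AE y in NF. y \<in> ?F"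
        unfolding NE_def NF_def by (simp_all add: AE_plane_measure)
      show ?thesis
      proof (rule nn_integral_cong_AE, rule eventually_mono[OF AE_F])
        fix y assume "y \<in> ?F"
        show "(\<integral>\<^sup>+x. indicator (cube R) (x + y) \<partial>NE) = (\<integral>\<^sup>+x. indicator (cube R) y * indicator (cube R) x \<partial>NE)"
          by (rule nn_integral_cong_AE, rule eventually_mono[OF AE_E], rule *[OF _ \<open>y \<in> ?F\<close>])
      qed
    qed
    also have "\<dots> = (\<integral>\<^sup>+y. indicator (cube R) y * emeasure NE (cube R) \<partial>NF)"
      by (intro nn_integral_cong) (simp add: nn_integral_cmult)
    also have "\<dots> = emeasure NF (cube R) * emeasure NE (cube R)"
      by (simp add: nn_integral_multc)
    finally show ?thesis .
  qed
  have \<nu>_pos: "0 < emeasure \<nu> (cube R)" "emeasure \<nu> (cube R) < \<infinity>" if "R > 0" for R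
    using cube_coord_plane_measure(2,3)[OF that, of K] cube_coord_plane_measure(2,3)[OF that, of "- K"]
    unfolding prod_eq NE_def NF_def by (simp_all add: ennreal_mult_less_top ennreal_zero_less_mult_iff)
  have "sigma_finite_measure \<nu>"
  proof (rule sigma_finite_measure_cubeI)
    show "emeasure \<nu> (cube R) \<noteq> \<infinity>" if "R > 0" for R
      using \<nu>_pos(2)[OF that] by simp
  qed (auto simp: \<nu>_def)
  define V where "V = emeasure lborel (cube 1 :: (real ^ 'n) set)"
  have V: "V \<noteq> 0" "V \<noteq> top" by (simp_all add: V_def emeasure_lborel_cube)
  define C where "C = emeasure \<nu> (cube 1) / V"
  have C: "0 < C" "C < \<infinity>"
    using \<nu>_pos[of 1] V
    by (auto simp: C_def ennreal_divide_eq_top_iff ennreal_zero_less_divide less_top[symmetric])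
  have "\<nu> = density lborel (\<lambda>_. C)"
  proof (rule measure_eqI)
    fix A assume "A \<in> sets \<nu>"
    then have A: "A \<in> sets borel" by simp
    have "emeasure \<nu> A * V = emeasure lborel A * emeasure \<nu> (cube 1)"
      unfolding V_def
      by (rule translation_invariant_measure_unique[OF sets_\<nu> \<open>sigma_finite_measure \<nu>\<close> \<nu>_inv A borel_cube]) auto
    then have "emeasure \<nu> A * V / V = emeasure lborel A * C"
      by (simp add: C_def ennreal_times_divide)
    then have "emeasure \<nu> A = emeasure lborel A * C"
      using V by (simp add: ennreal_mult_divide_eq)
    also have "\<dots> = emeasure (density lborel (\<lambda>_. C)) A"
      using A by (simp add: emeasure_density nn_integral_cmult_indicator mult.commute)
    finally show "emeasure \<nu> A = emeasure (density lborel (\<lambda>_. C)) A" .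
  qed simp
  then have "(\<integral>\<^sup>+z. g z \<partial>\<nu>) = C * (\<integral>\<^sup>+z. g z \<partial>lborel)" if "g \<in> borel_measurable borel" for g
    using that by (simp add: nn_integral_density nn_integral_cmult)
  then have "(\<integral>\<^sup>+y. \<integral>\<^sup>+x. g (x + y) \<partial>NE \<partial>NF) = C * (\<integral>\<^sup>+z. g z \<partial>lborel)"
    if "g \<in> borel_measurable borel" for g
    using that int[OF that] by metis
  then show thesis
    unfolding NE_def NF_def by (rule that[OF C])
qed

subsection \<open>Randomly rotated slabs\<close>

lemma orthogonal_matrix_cancel:
  fixes T :: "real ^ 'n ^ 'n"
  assumes "orthogonal_matrix T"
  shows "(T *v x) v* T = x" "T *v (x v* T) = x"
  using assms unfolding orthogonal_matrix_def transpose_matrix_vector[symmetric]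
  by (simp_all only: matrix_vector_mul_assoc matrix_vector_mul_lid)

lemma orthogonal_matrix_norm:
  fixes T :: "real ^ 'n ^ 'n"
  assumes "orthogonal_matrix T"
  shows "norm (T *v x) = norm x"
  using assms by (intro orthogonal_transformation_norm)
    (simp add: orthogonal_transformation_matrix)

lemma orthogonal_matrix_dist:
  fixes T :: "real ^ 'n ^ 'n"
  assumes "orthogonal_matrix T"
  shows "dist (T *v x) (T *v y) = dist x y"
  unfolding dist_norm matrix_vector_mult_diff_distrib[symmetric] using assms by (rule orthogonal_matrix_norm)

lemma orthogonal_matrix_exists:
  fixes x y :: "real ^ 'n"
  assumes "norm x = norm y"
  obtains S where "orthogonal_matrix S" "S *v x = y"
proof -
  obtain f where f: "orthogonal_transformation f" "f x = y"
    using orthogonal_transformation_exists[OF assms] by blast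
  then have "orthogonal_matrix (matrix f)" "matrix f *v x = y"
    by (simp_all add: orthogonal_transformation_matrix matrix_works orthogonal_transformation_linear)
  then show thesis by (rule that)
qed

lemma matrix_vector_mult_borel [measurable]:
  "(\<lambda>x. (T :: real ^ 'n ^ 'm) *v x) \<in> borel_measurable borel"
  by (intro borel_measurable_continuous_onI linear_continuous_on matrix_vector_mul_bounded_linear)

lemma vector_matrix_mult_borel [measurable]:
  "(\<lambda>x. x v* (T :: real ^ 'n ^ 'm)) \<in> borel_measurable borel"
  unfolding transpose_matrix_vector[symmetric] by (rule matrix_vector_mult_borel)

text \<open>The image of Lebesgue measure under \<open>T\<close> is again translation invariant, a
  shift by \<open>a\<close> being a shift by \<open>a v* T\<close> before \<open>T\<close> is
  applied. Uniqueness leaves only a constant, and the unit ball, which \<open>T\<close> preserves,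
  shows that it is \<open>1\<close>.\<close>

lemma nn_integral_lborel_orthogonal:
  fixes T :: "real ^ 'n ^ 'n"
  assumes T: "orthogonal_matrix T" and g [measurable]: "g \<in> borel_measurable borel"
  shows "(\<integral>\<^sup>+x. g (T *v x) \<partial>lborel) = (\<integral>\<^sup>+x. g x \<partial>lborel)"
proof -
  define \<nu> where "\<nu> = distr lborel borel (\<lambda>x. T *v x)"
  have sets: "sets \<nu> = sets borel" by (simp add: \<nu>_def)
  have lborel_inv: "(\<integral>\<^sup>+y. g (y + a) \<partial>lborel) = (\<integral>\<^sup>+y. g y \<partial>lborel)"
    if "g \<in> borel_measurable borel" for g and a :: "real ^ 'n"
    using nn_integral_distr[of "(+) a" lborel borel g] that by (simp add: lborel_distr_plus add.commute)
  have int: "(\<integral>\<^sup>+x. g x \<partial>\<nu>) = (\<integral>\<^sup>+x. g (T *v x) \<partial>lborel)" if "g \<in> borel_measurable borel" for g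
    unfolding \<nu>_def using that by (intro nn_integral_distr) auto
  have inv: "(\<integral>\<^sup>+x. g (x + a) \<partial>\<nu>) = (\<integral>\<^sup>+x. g x \<partial>\<nu>)" if [measurable]: "g \<in> borel_measurable borel" for g a
  proof -
    have "(\<integral>\<^sup>+x. g (x + a) \<partial>\<nu>) = (\<integral>\<^sup>+x. g (T *v (x + a v* T)) \<partial>lborel)"
      by (subst int) (simp_all add: matrix_vector_right_distrib orthogonal_matrix_cancel[OF T])
    also have "\<dots> = (\<integral>\<^sup>+x. g x \<partial>\<nu>)"
      by (subst lborel_inv[where g="\<lambda>x. g (T *v x)"]) (simp_all add: int)
    finally show ?thesis .
  qed
  let ?B = "cball 0 1 :: (real ^ 'n) set"
  have "(\<lambda>x. T *v x) -` ?B = ?B"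
    by (auto simp: orthogonal_matrix_norm[OF T])
  then have \<nu>B: "emeasure \<nu> ?B = emeasure lborel ?B"
    by (simp add: \<nu>_def emeasure_distr)
  have "0 < measure lborel (ball (0 :: real ^ 'n) 1)" by (rule content_ball_pos) simp
  also have "\<dots> \<le> measure lborel ?B"
    using emeasure_lborel_cball_finite[of "0 :: real ^ 'n" 1]
    by (intro measure_mono_fmeasurable) (auto simp: fmeasurable_def)
  finally have B: "emeasure lborel ?B \<noteq> 0" by (auto simp: measure_def)
  have "sigma_finite_measure \<nu>"
  proof (rule sigma_finite_measure_cubeI)
    fix R :: real assume "R > 0"
    have "bounded ((\<lambda>x. T *v x) -` cube R)"
      unfolding bounded_iff
    proof (intro exI ballI)
      fix x assume x: "x \<in> (\<lambda>x. T *v x) -` cube R"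
      have "norm x = norm (T *v x)" by (simp add: orthogonal_matrix_norm[OF T])
      also have "\<dots> \<le> (\<Sum>i\<in>UNIV. \<bar>(T *v x) $ i\<bar>)" by (rule norm_le_l1_cart)
      also have "\<dots> \<le> (\<Sum>i\<in>(UNIV :: 'n set). R)" using x by (intro sum_mono) auto
      finally show "norm x \<le> (\<Sum>i\<in>(UNIV :: 'n set). R)" .
    qed
    then show "emeasure \<nu> (cube R) \<noteq> \<infinity>"
      using emeasure_bounded_finite[of "(\<lambda>x. T *v x) -` cube R"] by (simp add: \<nu>_def emeasure_distr)
  qed (auto simp: \<nu>_def)
  then have "emeasure \<nu> A = emeasure lborel A" if "A \<in> sets borel" for A
    using translation_invariant_measure_unique[OF sets _ inv that, of ?B] B emeasure_lborel_cball_finite[of "0 :: real ^ 'n" 1]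
    by (auto simp: \<nu>B mult.commute[of _ "emeasure lborel ?B"] ennreal_mult_cancel_left)
  then have "\<nu> = lborel" by (intro measure_eqI) (auto simp: \<nu>_def)
  then show ?thesis using int[OF g] by simp
qed

text \<open>
  The neighbourhood of \<open>coord_plane K\<close> of radius \<open>R\<close> is taken in the maximum norm, so that its
  intersections with boxes are boxes.
\<close>

definition slab :: "'n set \<Rightarrow> real \<Rightarrow> (real ^ 'n) set" where
  "slab K R = {x. \<forall>i. i \<notin> K \<longrightarrow> \<bar>x $ i\<bar> \<le> R}"

lemma borel_slab [measurable]: "slab K R \<in> sets borel"
proof -
  have "slab K R = (\<Inter>i\<in>-K. {x. \<bar>x $ i\<bar> \<le> R})" by (auto simp: slab_def)
  then have "closed (slab K R)" by (auto intro!: closed_INT closed_Collect_le continuous_intros)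
  then show ?thesis by (rule borel_closed)
qed

lemma slab_mono: "R \<le> R' \<Longrightarrow> x \<in> slab K R \<Longrightarrow> x \<in> slab K R'"
  by (auto simp: slab_def intro: order_trans)

lemma slab_scale: "c > 0 \<Longrightarrow> c *\<^sub>R x \<in> slab K (c * R) \<longleftrightarrow> x \<in> slab K R"
  by (auto simp: slab_def abs_mult)

section \<open>Probability that a randomly rotated slab contains a given point\<close>

lemma orthogonal_haar_space:
  assumes "orthogonal_haar \<mu>"
  shows "space \<mu> = {T. orthogonal_matrix T}"
  using assms sets_eq_imp_space_eq[of \<mu> "restrict_space borel {T. orthogonal_matrix T}"]
  by (simp add: orthogonal_haar_def space_restrict_space)

lemma orthogonal_haar_finite_measure:
  assumes "orthogonal_haar \<mu>"
  shows "finite_measure \<mu>"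
  using assms by (intro finite_measureI) (simp add: orthogonal_haar_def)

lemma orthogonal_haar_measurable:
  fixes \<mu> :: "(real ^ 'n ^ 'n) measure"
  assumes "orthogonal_haar \<mu>"
  shows "(\<lambda>T. T) \<in> borel_measurable \<mu>"
proof -
  have "sets \<mu> = sets (restrict_space borel {T. orthogonal_matrix T})"
    using assms by (simp add: orthogonal_haar_def)
  show ?thesis
    unfolding measurable_cong_sets[OF \<open>sets \<mu> = _\<close> refl] by (simp add: measurable_restrict_space1)
qed

lemma orthogonal_haar_vector_mult_measurable:
  fixes \<mu> :: "(real ^ 'n ^ 'n) measure"
  assumes "orthogonal_haar \<mu>"
  shows "(\<lambda>p. snd p v* fst p) \<in> borel_measurable (\<mu> \<Otimes>\<^sub>M borel)"
proof -
  have "continuous_on UNIV (\<lambda>p :: (real ^ 'n ^ 'n) \<times> (real ^ 'n). snd p v* fst p)"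
    unfolding vector_matrix_mult_def by (intro continuous_intros)
  then have *: "(\<lambda>p :: (real ^ 'n ^ 'n) \<times> (real ^ 'n). snd p v* fst p) \<in> borel_measurable (borel \<Otimes>\<^sub>M borel)"
    unfolding borel_prod by (rule borel_measurable_continuous_onI)
  have "(\<lambda>p. (fst p, snd p)) \<in> \<mu> \<Otimes>\<^sub>M borel \<rightarrow>\<^sub>M borel \<Otimes>\<^sub>M (borel :: (real ^ 'n) measure)"
    using measurable_compose[OF measurable_fst orthogonal_haar_measurable[OF assms]]
    by (intro measurable_Pair) auto
  from measurable_compose[OF this *] show ?thesis by simp
qed

text \<open>
  For orthogonal \<open>T\<close>, \<open>x v* T\<close> is the preimage of \<open>x\<close> under \<open>T\<close>, so the event is that the rotated
  slab \<open>T (slab K R)\<close> contains \<open>x\<close>.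
\<close>

definition slab_prob :: "(real ^ 'n ^ 'n) measure \<Rightarrow> 'n set \<Rightarrow> real \<Rightarrow> real ^ 'n \<Rightarrow> real" where
  "slab_prob \<mu> K R x = measure \<mu> {T \<in> space \<mu>. x v* T \<in> slab K R}"

context
  fixes \<mu> :: "(real ^ 'n ^ 'n) measure" and K :: "'n set"
  assumes haar: "orthogonal_haar \<mu>"
begin

interpretation \<mu>: finite_measure \<mu> by (rule orthogonal_haar_finite_measure[OF haar])

lemmas haar_vector_mult [measurable] = orthogonal_haar_vector_mult_measurable[OF haar]

lemma haar_vector_mult_fixed [measurable]: "(\<lambda>T. x v* T) \<in> borel_measurable \<mu>"
  using measurable_compose[OF measurable_Pair2' haar_vector_mult, of x] by simp

lemma slab_prob_nn_integral:
  "ennreal (slab_prob \<mu> K R x) = (\<integral>\<^sup>+T. indicator (slab K R) (x v* T) \<partial>\<mu>)"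
proof -
  have "(\<integral>\<^sup>+T. indicator (slab K R) (x v* T) \<partial>\<mu>)
      = (\<integral>\<^sup>+T. indicator {T \<in> space \<mu>. x v* T \<in> slab K R} T \<partial>\<mu>)"
    by (intro nn_integral_cong) (auto simp: indicator_def)
  then show ?thesis
    unfolding slab_prob_def \<mu>.emeasure_eq_measure[symmetric] by simp
qed

lemma slab_prob_le_1: "slab_prob \<mu> K R x \<le> 1"
proof -
  have "slab_prob \<mu> K R x \<le> measure \<mu> (space \<mu>)"
    unfolding slab_prob_def by (rule \<mu>.bounded_measure)
  also have "\<dots> = 1" using haar by (simp add: orthogonal_haar_def measure_def)
  finally show ?thesis .
qed

lemma slab_prob_nonneg: "0 \<le> slab_prob \<mu> K R x"
  by (simp add: slab_prob_def)

lemma slab_prob_mono: "R \<le> R' \<Longrightarrow> slab_prob \<mu> K R x \<le> slab_prob \<mu> K R' x"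
  unfolding slab_prob_def
  by (intro \<mu>.finite_measure_mono subsetI) (auto intro: slab_mono)

lemma slab_prob_scale: "c > 0 \<Longrightarrow> slab_prob \<mu> K (c * R) (c *\<^sub>R x) = slab_prob \<mu> K R x"
  by (simp only: slab_prob_def scaleR_vector_matrix_assoc slab_scale)

text \<open>Some orthogonal \<open>S\<close> carries \<open>x\<close> to \<open>y\<close>, and left
  multiplication by \<open>S\<close> maps the event for \<open>x\<close> onto the event for
  \<open>y\<close>, because \<open>y v* (S ** T) = x v* T\<close>. Together with scaling this
  reduces everything to unit vectors.\<close>

lemma slab_prob_cong_norm:
  assumes "norm x = norm y"
  shows "slab_prob \<mu> K R x = slab_prob \<mu> K R y"
proof -
  obtain S where S: "orthogonal_matrix S" "S *v x = y" using orthogonal_matrix_exists[OF assms] .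
  let ?X = "{T \<in> space \<mu>. x v* T \<in> slab K R}"
  let ?Y = "{T \<in> space \<mu>. y v* T \<in> slab K R}"
  have S': "y v* S = x" using orthogonal_matrix_cancel(1)[OF S(1), of x] S(2) by simp
  have SS: "S ** (transpose S ** T) = T" for T :: "real ^ 'n ^ 'n"
    using S(1) by (simp add: matrix_mul_assoc orthogonal_matrix_def)
  have "(\<lambda>T. S ** T) ` ?X = ?Y"
  proof (intro equalityI subsetI)
    fix T assume "T \<in> (\<lambda>T. S ** T) ` ?X"
    then obtain T' where T': "orthogonal_matrix T'" "x v* T' \<in> slab K R" "T = S ** T'"
      by (auto simp: orthogonal_haar_space[OF haar])
    have "y v* T = x v* T'" by (simp add: T'(3) S' flip: vector_matrix_mul_assoc)
    then show "T \<in> ?Y"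
      using T' S(1) by (simp add: orthogonal_haar_space[OF haar] orthogonal_matrix_mul)
  next
    fix T assume T: "T \<in> ?Y"
    have "x v* (transpose S ** T) = y v* T" by (simp add: S(2) flip: vector_matrix_mul_assoc)
    then have "transpose S ** T \<in> ?X"
      using S(1) T by (simp add: orthogonal_haar_space[OF haar] orthogonal_matrix_mul)
    then show "T \<in> (\<lambda>T. S ** T) ` ?X"
      by (rule image_eqI[where x="transpose S ** T", rotated]) (simp only: SS)
  qed
  moreover have "?X \<in> sets \<mu>" by measurable
  ultimately have "emeasure \<mu> ?Y = emeasure \<mu> ?X"
    using haar S(1) unfolding orthogonal_haar_def by fastforce
  then show ?thesis by (simp add: slab_prob_def measure_def)
qed

text \<open>Slabs are star-shaped about the origin, so shrinking a vector keeps it in every rotated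
  slab that contains it; the shrunk vector is then exchanged for one of the same norm.\<close>

lemma slab_prob_antimono:
  assumes "norm x \<le> norm y" "0 \<le> R"
  shows "slab_prob \<mu> K R y \<le> slab_prob \<mu> K R x"
proof (cases "y = 0")
  case True
  then show ?thesis using assms by simp
next
  case False
  define c where "c = norm x / norm y"
  have c: "0 \<le> c" "c \<le> 1" using assms False by (auto simp: c_def)
  have "slab_prob \<mu> K R y \<le> slab_prob \<mu> K R (c *\<^sub>R y)"
    unfolding slab_prob_def
  proof (intro \<mu>.finite_measure_mono subsetI)
    fix T assume T: "T \<in> {T \<in> space \<mu>. y v* T \<in> slab K R}"
    have "\<bar>c * (y v* T) $ i\<bar> \<le> R" if "i \<notin> K" for i
    proof -
      have "\<bar>(y v* T) $ i\<bar> \<le> R" using T that by (auto simp: slab_def)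
      then have "c * \<bar>(y v* T) $ i\<bar> \<le> 1 * R" using c by (intro mult_mono) auto
      then show ?thesis using c by (simp add: abs_mult)
    qed
    then show "T \<in> {T \<in> space \<mu>. (c *\<^sub>R y) v* T \<in> slab K R}"
      using T by (simp only: mem_Collect_eq slab_def scaleR_vector_matrix_assoc vector_scaleR_component
          real_scaleR_def) blast
  qed measurable
  also have "\<dots> = slab_prob \<mu> K R x"
    using False by (intro slab_prob_cong_norm) (simp add: c_def)
  finally show ?thesis .
qed

text \<open>The bridge between the two halves of the argument: plane bounds apply on the right, one
  rotation at a time, while radii can be compared on the left. It combines Tonelli with the
  invariance of Lebesgue measure under each \<open>T\<close>.\<close>

lemma nn_integral_slab_prob:
  assumes [measurable]: "f \<in> borel_measurable borel"
  shows "(\<integral>\<^sup>+x. f x * ennreal (slab_prob \<mu> K R x) \<partial>lborel)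
      = (\<integral>\<^sup>+T. \<integral>\<^sup>+x. f (T *v x) * indicator (slab K R) x \<partial>lborel \<partial>\<mu>)"
proof -
  interpret pair_sigma_finite \<mu> lborel ..
  have [measurable]: "(\<lambda>p. snd p v* fst p) \<in> borel_measurable (\<mu> \<Otimes>\<^sub>M lborel)"
    by (subst measurable_cong_sets[OF sets_pair_measure_cong[OF refl sets_lborel] refl]) measurable
  have "(\<integral>\<^sup>+x. f x * ennreal (slab_prob \<mu> K R x) \<partial>lborel)
      = (\<integral>\<^sup>+x. \<integral>\<^sup>+T. f x * indicator (slab K R) (x v* T) \<partial>\<mu> \<partial>lborel)"
    unfolding slab_prob_nn_integral by (intro nn_integral_cong nn_integral_cmult[symmetric]) measurable
  also have "\<dots> = (\<integral>\<^sup>+T. \<integral>\<^sup>+x. f x * indicator (slab K R) (x v* T) \<partial>lborel \<partial>\<mu>)"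
    by (rule Fubini') (unfold case_prod_unfold, measurable)
  also have "\<dots> = (\<integral>\<^sup>+T. \<integral>\<^sup>+x. f (T *v x) * indicator (slab K R) x \<partial>lborel \<partial>\<mu>)"
  proof (rule nn_integral_cong)
    fix T assume "T \<in> space \<mu>"
    then have T: "orthogonal_matrix T" by (simp add: orthogonal_haar_space[OF haar])
    show "(\<integral>\<^sup>+x. f x * indicator (slab K R) (x v* T) \<partial>lborel)
        = (\<integral>\<^sup>+x. f (T *v x) * indicator (slab K R) x \<partial>lborel)"
      by (subst nn_integral_lborel_orthogonal[OF T, symmetric]) (simp_all add: orthogonal_matrix_cancel[OF T])
  qed
  finally show ?thesis .
qed

lemma slab_prob_measurable [measurable]: "(\<lambda>x. ennreal (slab_prob \<mu> K R x)) \<in> borel_measurable borel"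
proof -
  have [measurable]: "(\<lambda>p. fst p v* snd p) \<in> borel_measurable (borel \<Otimes>\<^sub>M \<mu>)"
    using measurable_compose[OF measurable_pair_swap' haar_vector_mult] by (simp add: case_prod_unfold)
  show ?thesis
    unfolding slab_prob_nn_integral
    by (rule \<mu>.borel_measurable_nn_integral) (unfold case_prod_unfold, measurable)
qed

text \<open>Shells are invariant under rotations, so averaging over \<open>T\<close> changes nothing on the right.\<close>

lemma nn_integral_slab_prob_shell:
  assumes [measurable]: "I \<in> sets borel"
  shows "(\<integral>\<^sup>+x. indicator I (norm x) * ennreal (slab_prob \<mu> K R x) \<partial>lborel)
      = emeasure lborel ({x. norm x \<in> I} \<inter> slab K R)"
proof -
  have "{x :: real ^ 'n. norm x \<in> I} \<in> sets borel"
    using measurable_sets_borel[of norm borel I] by (simp add: vimage_def)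
  then have S: "{x. norm x \<in> I} \<inter> slab K R \<in> sets lborel" by simp
  have "(\<integral>\<^sup>+x. indicator I (norm x) * ennreal (slab_prob \<mu> K R x) \<partial>lborel)
      = (\<integral>\<^sup>+T. \<integral>\<^sup>+x. indicator I (norm (T *v x)) * indicator (slab K R) x \<partial>lborel \<partial>\<mu>)"
    by (rule nn_integral_slab_prob) measurable
  also have "\<dots> = (\<integral>\<^sup>+T. emeasure lborel ({x. norm x \<in> I} \<inter> slab K R) \<partial>\<mu>)"
  proof (rule nn_integral_cong)
    fix T assume "T \<in> space \<mu>"
    then have T: "orthogonal_matrix T" by (simp add: orthogonal_haar_space[OF haar])
    have "(\<integral>\<^sup>+x. indicator I (norm (T *v x)) * indicator (slab K R) x \<partial>lborel)
        = (\<integral>\<^sup>+x. indicator ({x. norm x \<in> I} \<inter> slab K R) x \<partial>lborel)"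
      by (intro nn_integral_cong) (simp add: orthogonal_matrix_norm[OF T] indicator_def)
    then show "(\<integral>\<^sup>+x. indicator I (norm (T *v x)) * indicator (slab K R) x \<partial>lborel)
        = emeasure lborel ({x. norm x \<in> I} \<inter> slab K R)"
      using S by simp
  qed
  also have "\<dots> = emeasure lborel ({x. norm x \<in> I} \<inter> slab K R)"
    using haar by (simp add: orthogonal_haar_def)
  finally show ?thesis .
qed

text \<open>For \<open>x\<close> in the shell \<open>A\<close>, scaling \<open>u\<close> to norm
  \<open>2\<close> shows that the probability at \<open>u\<close> with radius \<open>s\<close> is at
  most that at \<open>x\<close> with radius \<open>2 * s\<close>. Averaging over \<open>A\<close>
  leaves the volume of \<open>A\<close> inside a slab, which fits in a box with sides
  \<open>4\<close> along \<open>K\<close> and \<open>4 * s\<close> across; hence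
  \<open>C\<close>.\<close>

lemma slab_prob_upper:
  obtains C where "0 < C" "\<And>s u. 0 < s \<Longrightarrow> norm u = 1 \<Longrightarrow> slab_prob \<mu> K s u \<le> C * s ^ card (- K)"
proof -
  define A where "A = {x :: real ^ 'n. norm x \<in> {1..2}}"
  have A_sub: "A \<subseteq> cball 0 2" by (auto simp: A_def)
  have [measurable]: "A \<in> sets borel" unfolding A_def by measurable
  have A_fin: "A \<in> fmeasurable lborel"
    using emeasure_bounded_finite[OF bounded_subset[OF bounded_cball A_sub]] by (intro fmeasurableI) auto
  obtain e :: "real ^ 'n" where e: "norm e = 1" using vector_choose_size[of 1] by auto
  \<comment> \<open>The shell has positive volume: it contains a ball of radius \<open>1/2\<close>
    around a vector of norm \<open>3/2\<close>.\<close>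
  have "0 < measure lborel (ball ((3/2) *\<^sub>R e) (1/2))" by (rule content_ball_pos) simp
  also have "\<dots> \<le> measure lborel A"
  proof (rule measure_mono_fmeasurable[OF _ _ A_fin])
    show "ball ((3/2) *\<^sub>R e) (1/2) \<subseteq> A"
    proof
      fix x assume "x \<in> ball ((3/2) *\<^sub>R e) (1/2)"
      then have "norm ((3/2) *\<^sub>R e - x) < 1/2" by (simp add: dist_norm)
      then have "\<bar>norm ((3/2) *\<^sub>R e) - norm x\<bar> < 1/2"
        using norm_triangle_ineq3[of "(3/2) *\<^sub>R e" x] by linarith
      then have "\<bar>3/2 - norm x\<bar> < 1/2" using e by simp
      then have "1 \<le> norm x \<and> norm x \<le> 2" by linarith
      then show "x \<in> A" by (simp add: A_def)
    qed
  qed auto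
  finally have A_pos: "0 < measure lborel A" .
  define C where "C = 4 ^ card K * 4 ^ card (- K) / measure lborel A"
  show thesis
  proof (rule that)
    show "0 < C" using A_pos by (simp add: C_def)
    fix s :: real and u :: "real ^ 'n"
    assume s: "0 < s" and u: "norm u = 1"
    have "ennreal (slab_prob \<mu> K s u * measure lborel A) = (\<integral>\<^sup>+x. ennreal (slab_prob \<mu> K s u) * indicator A x \<partial>lborel)"
      using A_fin by (simp add: nn_integral_cmult emeasure_eq_measure2 ennreal_mult slab_prob_nonneg)
    also have "\<dots> \<le> (\<integral>\<^sup>+x. indicator {1..2} (norm x) * ennreal (slab_prob \<mu> K (2 * s) x) \<partial>lborel)"
    proof (rule nn_integral_mono)
      fix x :: "real ^ 'n"
      have "slab_prob \<mu> K s u \<le> slab_prob \<mu> K (2 * s) x" if "x \<in> A"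
      proof -
        have "slab_prob \<mu> K s u = slab_prob \<mu> K (2 * s) (2 *\<^sub>R u)" by (simp only: slab_prob_scale zero_less_numeral)
        also have "\<dots> \<le> slab_prob \<mu> K (2 * s) x"
          using that u s by (intro slab_prob_antimono) (auto simp: A_def)
        finally show ?thesis .
      qed
      then show "ennreal (slab_prob \<mu> K s u) * indicator A x \<le> indicator {1..2} (norm x) * ennreal (slab_prob \<mu> K (2 * s) x)"
        by (cases "x \<in> A") (auto simp: A_def intro: ennreal_leI)
    qed
    also have "\<dots> = emeasure lborel (A \<inter> slab K (2 * s))"
      unfolding A_def by (rule nn_integral_slab_prob_shell) simp
    also have "\<dots> \<le> emeasure lborel {x. \<forall>i. \<bar>x $ i - (0 :: real ^ 'n) $ i\<bar> \<le> (if i \<in> K then 2 else 2 * s)}"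
    proof (rule emeasure_mono)
      show "A \<inter> slab K (2 * s) \<subseteq> {x. \<forall>i. \<bar>x $ i - (0 :: real ^ 'n) $ i\<bar> \<le> (if i \<in> K then 2 else 2 * s)}"
        using component_le_norm_cart by (auto simp: A_def slab_def intro: order_trans)
    qed auto
    also have "\<dots> = ennreal ((2 * 2) ^ card K * (2 * (2 * s)) ^ card (- K))"
      using s by (intro emeasure_lborel_box_split) auto
    finally have "slab_prob \<mu> K s u * measure lborel A \<le> 4 ^ card K * (4 * s) ^ card (- K)"
      using s by (subst (asm) ennreal_le_iff) (auto simp: mult.assoc[symmetric])
    then show "slab_prob \<mu> K s u \<le> C * s ^ card (- K)"
      using A_pos by (simp add: C_def pos_le_divide_eq power_mult_distrib mult_ac)
  qed
qed

text \<open>On a shell outside the unit ball the probability is at most its value at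
  \<open>u\<close>, so its average there, a volume, bounds that value from below. The volume is at
  least that of a box inside the shell and the slab, centred at \<open>a\<close>; an index in
  \<open>K\<close> is needed to push this box away from the origin.\<close>

lemma slab_prob_lower:
  assumes "K \<noteq> {}"
  obtains c where "0 < c" "\<And>s u. 0 < s \<Longrightarrow> norm u = 1 \<Longrightarrow> s \<le> 1 \<Longrightarrow> c * s ^ card (- K) \<le> slab_prob \<mu> K s u"
proof -
  \<comment> \<open>All coordinates of points in the box are at most \<open>2\<close> in absolute
    value, so their sum norm is at most \<open>d\<close>.\<close>
  define d where "d = 2 * real CARD('n)"
  define A where "A = {x :: real ^ 'n. norm x \<in> {1..d}}"
  have A_sub: "A \<subseteq> cball 0 d" by (auto simp: A_def)
  have [measurable]: "A \<in> sets borel" unfolding A_def by measurable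
  have A_fin: "A \<in> fmeasurable lborel"
    using emeasure_bounded_finite[OF bounded_subset[OF bounded_cball A_sub]] by (intro fmeasurableI) auto
  define a :: "real ^ 'n" where "a = (\<chi> i. if i \<in> K then 3/2 else 0)"
  have main: "2 ^ card (- K) * s ^ card (- K) \<le> slab_prob \<mu> K s u * measure lborel A"
    if s: "0 < s" "s \<le> 1" and u: "norm u = 1" for s and u :: "real ^ 'n"
  proof -
    have "ennreal ((2 * (1/2)) ^ card K * (2 * s) ^ card (- K))
        = emeasure lborel {x. \<forall>i. \<bar>x $ i - a $ i\<bar> \<le> (if i \<in> K then 1/2 else s)}"
      using s by (intro emeasure_lborel_box_split[symmetric]) auto
    also have "\<dots> \<le> emeasure lborel (A \<inter> slab K s)"
    proof (rule emeasure_mono)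
      show "{x. \<forall>i. \<bar>x $ i - a $ i\<bar> \<le> (if i \<in> K then 1/2 else s)} \<subseteq> A \<inter> slab K s"
      proof
        fix x assume "x \<in> {x. \<forall>i. \<bar>x $ i - a $ i\<bar> \<le> (if i \<in> K then 1/2 else s)}"
        then have x: "\<bar>x $ i - a $ i\<bar> \<le> (if i \<in> K then 1/2 else s)" for i by blast
        have xK: "1 \<le> x $ i \<and> x $ i \<le> 2" if "i \<in> K" for i
        proof -
          have "\<bar>x $ i - 3/2\<bar> \<le> 1/2" using x[of i] that by (simp add: a_def)
          then show ?thesis by linarith
        qed
        have xK': "\<bar>x $ i\<bar> \<le> s" if "i \<notin> K" for i using x[of i] that by (auto simp: a_def)
        obtain i where "i \<in> K" using assms by blast
        then have "1 \<le> norm x" using component_le_norm_cart[of x i] xK[of i] by linarith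
        moreover have "norm x \<le> (\<Sum>i\<in>UNIV. \<bar>x $ i\<bar>)" by (rule norm_le_l1_cart)
        moreover have "\<bar>x $ i\<bar> \<le> 2" for i using xK[of i] xK'[of i] s by (cases "i \<in> K") auto
        then have "(\<Sum>i\<in>UNIV. \<bar>x $ i\<bar>) \<le> (\<Sum>i\<in>(UNIV :: 'n set). 2)" by (intro sum_mono)
        ultimately show "x \<in> A \<inter> slab K s" using xK' by (auto simp: A_def slab_def d_def)
      qed
    qed auto
    also have "\<dots> = (\<integral>\<^sup>+x. indicator {1..d} (norm x) * ennreal (slab_prob \<mu> K s x) \<partial>lborel)"
      unfolding A_def by (rule nn_integral_slab_prob_shell[symmetric]) simp
    also have "\<dots> \<le> (\<integral>\<^sup>+x. ennreal (slab_prob \<mu> K s u) * indicator A x \<partial>lborel)"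
    proof (rule nn_integral_mono)
      fix x :: "real ^ 'n"
      have "slab_prob \<mu> K s x \<le> slab_prob \<mu> K s u" if "x \<in> A"
        using that u s by (intro slab_prob_antimono) (auto simp: A_def)
      then show "indicator {1..d} (norm x) * ennreal (slab_prob \<mu> K s x) \<le> ennreal (slab_prob \<mu> K s u) * indicator A x"
        by (cases "x \<in> A") (auto simp: A_def intro: ennreal_leI)
    qed
    also have "\<dots> = ennreal (slab_prob \<mu> K s u * measure lborel A)"
      using A_fin by (simp add: nn_integral_cmult emeasure_eq_measure2 ennreal_mult slab_prob_nonneg)
    finally show ?thesis
      by (subst (asm) ennreal_le_iff) (auto simp: slab_prob_nonneg power_mult_distrib)
  qed
  \<comment> \<open>Positive volume of the shell follows from the estimate itself, taken at
    \<open>s = 1\<close>.\<close>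
  obtain e :: "real ^ 'n" where "norm e = 1" using vector_choose_size[of 1] by auto
  from main[OF _ _ this, of 1] have "2 ^ card (- K) \<le> slab_prob \<mu> K 1 e * measure lborel A" by simp
  moreover have "(0 :: real) < 2 ^ card (- K)" by simp
  ultimately have "measure lborel A \<noteq> 0" by (intro notI) simp
  then have A_pos: "0 < measure lborel A" by (simp add: zero_less_measure_iff)
  show thesis
  proof (rule that)
    show "0 < 2 ^ card (- K) / measure lborel A" using A_pos by simp
    show "2 ^ card (- K) / measure lborel A * s ^ card (- K) \<le> slab_prob \<mu> K s u"
      if "0 < s" "norm u = 1" "s \<le> 1" for s u
      using main[OF that(1,3,2)] A_pos by (simp add: pos_divide_le_eq)
  qed
qed

text \<open>After scaling to unit vectors, the radius is \<open>R / norm x\<close> on the left and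
  \<open>1 / norm x\<close> on the right. Far from the origin both power bounds apply and the powers
  of \<open>R\<close> cancel; near it the left side is at most \<open>1\<close> and the right one is
  bounded below by the value at radius \<open>1\<close>.\<close>

lemma slab_prob_dominated:
  assumes "K \<noteq> {}"
  obtains C where "0 < C"
    "\<And>R x. 1 \<le> R \<Longrightarrow> x \<noteq> 0 \<Longrightarrow> slab_prob \<mu> K R x / R ^ card (- K) \<le> C * slab_prob \<mu> K 1 x"
proof -
  let ?q = "card (- K)"
  obtain C where C: "0 < C" "\<And>s u. 0 < s \<Longrightarrow> norm u = 1 \<Longrightarrow> slab_prob \<mu> K s u \<le> C * s ^ ?q"
    using slab_prob_upper by blast
  obtain c where c: "0 < c" "\<And>s u. 0 < s \<Longrightarrow> norm u = 1 \<Longrightarrow> s \<le> 1 \<Longrightarrow> c * s ^ ?q \<le> slab_prob \<mu> K s u"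
    using slab_prob_lower[OF assms] by blast
  have unit: "slab_prob \<mu> K R x = slab_prob \<mu> K (R / norm x) (x /\<^sub>R norm x)" if "x \<noteq> 0" for R x
    using slab_prob_scale[of "inverse (norm x)" R x] that by (simp add: divide_inverse mult.commute)
  have norm1: "norm (x /\<^sub>R norm x) = 1" if "x \<noteq> 0" for x :: "real ^ 'n" using that by simp
  have low_large: "c / norm x ^ ?q \<le> slab_prob \<mu> K 1 x" if "1 \<le> norm x" for x
  proof -
    have "x \<noteq> 0" using that by auto
    then show ?thesis
      using c(2)[OF _ norm1, of "1 / norm x" x] that by (simp add: unit[of x 1] power_divide)
  qed
  have low_small: "c \<le> slab_prob \<mu> K 1 x" if "x \<noteq> 0" "norm x \<le> 1" for x
  proof -
    have "c \<le> slab_prob \<mu> K 1 (x /\<^sub>R norm x)" using c(2)[OF _ norm1[OF that(1)], of 1] by simp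
    also have "\<dots> \<le> slab_prob \<mu> K (1 / norm x) (x /\<^sub>R norm x)"
      using that by (intro slab_prob_mono) simp
    finally show ?thesis by (simp only: unit[OF that(1), of 1])
  qed
  show thesis
  proof (rule that)
    \<comment> \<open>Points with \<open>norm x \<le> 1\<close> require the factor
      \<open>1 / c\<close>, the others \<open>C / c\<close>; the sum serves both.\<close>
    show "0 < (C + 1) / c" using C c by simp
    fix x :: "real ^ 'n" assume x: "x \<noteq> 0"
    have low: "norm x \<le> 1 \<and> c \<le> slab_prob \<mu> K 1 x \<or> 1 \<le> norm x \<and> c / norm x ^ ?q \<le> slab_prob \<mu> K 1 x"
      using low_small[OF x] low_large[of x] linear[of "norm x" 1] by blast
    fix R :: real assume R: "1 \<le> R"
    have "slab_prob \<mu> K R x / R ^ ?q \<le> (C + 1) / c * slab_prob \<mu> K 1 x"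
      using low
    proof
      assume *: "norm x \<le> 1 \<and> c \<le> slab_prob \<mu> K 1 x"
      have "slab_prob \<mu> K R x / R ^ ?q \<le> 1 / 1"
        using R by (intro frac_le slab_prob_le_1 one_le_power) auto
      also have "\<dots> \<le> (C + 1) / c * c" using C c by simp
      also have "\<dots> \<le> (C + 1) / c * slab_prob \<mu> K 1 x"
        using * C c by (intro mult_left_mono) auto
      finally show ?thesis .
    next
      assume *: "1 \<le> norm x \<and> c / norm x ^ ?q \<le> slab_prob \<mu> K 1 x"
      have "slab_prob \<mu> K R x \<le> C * (R / norm x) ^ ?q"
        unfolding unit[OF x, of R] using C(2)[OF _ norm1[OF x], of "R / norm x"] R x by simp
      then have "slab_prob \<mu> K R x / R ^ ?q \<le> C * (R / norm x) ^ ?q / R ^ ?q"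
        using R by (intro divide_right_mono) auto
      also have "\<dots> = C / c * (c / norm x ^ ?q)"
        using R c(1) by (simp add: power_divide)
      also have "\<dots> \<le> (C + 1) / c * slab_prob \<mu> K 1 x"
        using * C c by (intro mult_mono divide_right_mono) auto
      finally show ?thesis .
    qed
    then show "slab_prob \<mu> K R x / R ^ ?q \<le> (C + 1) / c * slab_prob \<mu> K 1 x" .
  qed
qed

end

subsection \<open>Plane integrals\<close>

text \<open>The isometry taking \<open>x\<close> to \<open>T *v (x + y)\<close> pulls the integral
  back to the coordinate plane. By the disintegration applied to the rotated null set, almost every
  parallel plane meets the set where \<open>f\<close> and \<open>f'\<close> differ in Hausdorff
  measure \<open>0\<close>, so changing \<open>f\<close> there is harmless.\<close>

lemma rotated_plane_integral:
  fixes f f' :: "real ^ 'n \<Rightarrow> real" and K :: "'n set"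
  assumes T: "orthogonal_matrix T"
    and f' [measurable]: "f' \<in> borel_measurable borel"
    and ae: "AE x in lborel. f x = f' x"
  shows "AE y in plane_measure (card (- K)) (coord_plane (- K)).
      (\<integral>\<^sup>+x\<in>(\<lambda>x. x + T *v y) ` ((*v) T ` coord_plane K). ennreal (f x) \<partial>hausdorff_measure (card K))
      = (\<integral>\<^sup>+x. ennreal (f' (T *v (x + y))) \<partial>plane_measure (card K) (coord_plane K))"
proof -
  let ?E = "coord_plane K" and ?F = "coord_plane (- K)"
  let ?NE = "plane_measure (card K) ?E" and ?NF = "plane_measure (card (- K)) ?F"
  interpret NE: sigma_finite_measure ?NE by (rule sigma_finite_coord_plane_measure)
  obtain N where N: "{x. f x \<noteq> f' x} \<subseteq> N" "emeasure lborel N = 0" and "N \<in> sets lborel"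
    using ae by (auto elim!: AE_E)
  then have N_borel [measurable]: "N \<in> sets borel" by simp
  have id_E: "(\<lambda>x. x) \<in> borel_measurable ?NE" by (intro measurable_plane_borel) simp
  have snd_m [measurable]: "snd \<in> borel_measurable ((borel :: (real ^ 'n) measure) \<Otimes>\<^sub>M ?NE)"
    by (rule measurable_compose[OF measurable_snd id_E])
  have inner_m: "(\<lambda>y. \<integral>\<^sup>+x. indicator N (T *v (x + y)) \<partial>?NE) \<in> borel_measurable borel"
    by (rule NE.borel_measurable_nn_integral) (unfold case_prod_unfold, measurable)
  obtain C where C: "\<And>g :: real ^ 'n \<Rightarrow> ennreal. g \<in> borel_measurable borel \<Longrightarrow>
      (\<integral>\<^sup>+y. (\<integral>\<^sup>+x. g (x + y) \<partial>?NE) \<partial>?NF) = C * (\<integral>\<^sup>+x. g x \<partial>lborel)"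
    using lborel_coord_plane_disintegration[of K] by blast
  have "(\<integral>\<^sup>+y. \<integral>\<^sup>+x. indicator N (T *v (x + y)) \<partial>?NE \<partial>?NF) = C * (\<integral>\<^sup>+x. indicator N (T *v x) \<partial>lborel)"
    by (rule C) measurable
  also have "\<dots> = 0"
    using N(2) by (simp add: nn_integral_lborel_orthogonal[OF T, of "indicator N"])
  finally have "AE y in ?NF. (\<integral>\<^sup>+x. indicator N (T *v (x + y)) \<partial>?NE) = 0"
    by (subst (asm) nn_integral_0_iff_AE) (auto intro: measurable_plane_borel[OF inner_m])
  then show ?thesis
  proof (rule eventually_mono)
    fix y
    assume 0: "(\<integral>\<^sup>+x. indicator N (T *v (x + y)) \<partial>?NE) = 0"
    define \<phi> where "\<phi> x = T *v (x + y)" for x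
    define P where "P = (\<lambda>x. x + T *v y) ` ((*v) T ` ?E)"
    have \<phi>_dist: "dist (\<phi> a) (\<phi> b) = dist a b" for a b
      by (simp add: \<phi>_def orthogonal_matrix_dist[OF T])
    have \<phi>_inv: "\<phi> (z v* T - y) = z" for z by (simp add: \<phi>_def orthogonal_matrix_cancel[OF T])
    have \<phi>_inv': "\<phi> z v* T - y = z" for z by (simp add: \<phi>_def orthogonal_matrix_cancel[OF T])
    have \<phi>_surj: "surj \<phi>" using \<phi>_inv by (rule surjI)
    have \<phi>_m [measurable]: "\<phi> \<in> borel_measurable borel" unfolding \<phi>_def by measurable
    \<comment> \<open>As a preimage under a continuous map, \<open>P\<close> is seen to be
      Borel.\<close>
    have P: "P = {z. z v* T - y \<in> ?E}"
    proof -
      have "P = \<phi> ` ?E" by (simp add: P_def \<phi>_def image_image matrix_vector_right_distrib)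
      also have "\<dots> = {z. z v* T - y \<in> ?E}"
      proof (intro equalityI subsetI)
        fix z assume "z \<in> {z. z v* T - y \<in> ?E}"
        then show "z \<in> \<phi> ` ?E" by (intro image_eqI[where x="z v* T - y"]) (simp_all add: \<phi>_inv)
      qed (auto simp: \<phi>_inv')
      finally show ?thesis .
    qed
    have [measurable]: "P \<in> sets borel" unfolding P by measurable
    have \<phi>_P: "\<phi> x \<in> P \<longleftrightarrow> x \<in> ?E" for x by (simp add: P \<phi>_inv')
    have "AE x in ?NE. indicator N (\<phi> x) = (0 :: ennreal)"
      using 0 unfolding \<phi>_def[symmetric]
      by (subst (asm) nn_integral_0_iff_AE) (auto intro!: measurable_plane_borel)
    then have "AE x in hausdorff_measure (card K). \<phi> x \<in> P \<longrightarrow> \<phi> x \<notin> N"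
      unfolding AE_plane_measure[OF borel_coord_plane] \<phi>_P by (simp add: indicator_eq_0_iff)
    then have "AE z in hausdorff_measure (card K). z \<in> P \<longrightarrow> z \<notin> N"
      by (simp only: AE_hausdorff_isometry[OF \<phi>_dist \<phi>_surj, where P="\<lambda>z. z \<in> P \<longrightarrow> z \<notin> N"])
    then have "(\<integral>\<^sup>+z\<in>P. ennreal (f z) \<partial>hausdorff_measure (card K)) = (\<integral>\<^sup>+z. ennreal (f' z) * indicator P z \<partial>hausdorff_measure (card K))"
    \<comment> \<open>Agreement almost everywhere on \<open>P\<close> suffices here:
      \<open>f\<close> itself may fail to be measurable for the Hausdorff measure, and from this
      point the Borel function \<open>f'\<close> replaces it.\<close>
    proof (intro nn_integral_cong_AE, elim eventually_mono)
      fix z assume z: "z \<in> P \<longrightarrow> z \<notin> N"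
      show "ennreal (f z) * indicator P z = ennreal (f' z) * indicator P z"
      proof (cases "z \<in> P")
        case True
        then have "f z = f' z" using z N(1) by blast
        then show ?thesis by simp
      qed simp
    qed
    also have "\<dots> = (\<integral>\<^sup>+x. ennreal (f' (\<phi> x)) * indicator P (\<phi> x) \<partial>hausdorff_measure (card K))"
      by (rule nn_integral_hausdorff_isometry[OF \<phi>_dist \<phi>_surj, symmetric]) measurable
    also have "\<dots> = (\<integral>\<^sup>+x. indicator ?E x * ennreal (f' (\<phi> x)) \<partial>hausdorff_measure (card K))"
      by (intro nn_integral_cong) (simp add: indicator_def \<phi>_P)
    also have "\<dots> = (\<integral>\<^sup>+x. ennreal (f' (\<phi> x)) \<partial>?NE)"
      by (rule nn_integral_plane_measure[symmetric]) measurable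
    finally show "(\<integral>\<^sup>+x\<in>(\<lambda>x. x + T *v y) ` ((*v) T ` ?E). ennreal (f x) \<partial>hausdorff_measure (card K))
        = (\<integral>\<^sup>+x. ennreal (f' (T *v (x + y))) \<partial>?NE)"
      by (simp only: P_def \<phi>_def)
  qed
qed

text \<open>The slab is the sum of the coordinate plane and a cube in the complementary plane, so
  integrating the plane bounds over that cube gives bounds for the integral over the slab, up to the
  disintegration constant.\<close>

lemma rotated_slab_integral_bounds:
  fixes f f' :: "real ^ 'n \<Rightarrow> real" and K :: "'n set" and m M :: ennreal
  defines "NE \<equiv> plane_measure (card K) (coord_plane K)"
    and "NF \<equiv> plane_measure (card (- K)) (coord_plane (- K))"
  assumes T: "orthogonal_matrix T"
    and f' [measurable]: "f' \<in> borel_measurable borel"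
    and ae: "AE x in lborel. f x = f' x"
    and planes: "AE y \<in> ((*v) T ` coord_plane K)\<^sup>\<bottom> in hausdorff_measure (card (- K)).
        m \<le> (\<integral>\<^sup>+x\<in>(\<lambda>x. x + y) ` ((*v) T ` coord_plane K). ennreal (f x) \<partial>hausdorff_measure (card K)) \<and>
        (\<integral>\<^sup>+x\<in>(\<lambda>x. x + y) ` ((*v) T ` coord_plane K). ennreal (f x) \<partial>hausdorff_measure (card K)) \<le> M"
    and C: "\<And>g :: real ^ 'n \<Rightarrow> ennreal. g \<in> borel_measurable borel \<Longrightarrow>
      (\<integral>\<^sup>+y. (\<integral>\<^sup>+x. g (x + y) \<partial>NE) \<partial>NF) = C * (\<integral>\<^sup>+x. g x \<partial>lborel)"
    and "0 \<le> R"
  shows "m * emeasure NF (cube R) \<le> C * (\<integral>\<^sup>+x. ennreal (f' (T *v x)) * indicator (slab K R) x \<partial>lborel)"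
    and "C * (\<integral>\<^sup>+x. ennreal (f' (T *v x)) * indicator (slab K R) x \<partial>lborel) \<le> M * emeasure NF (cube R)"
proof -
  let ?E = "coord_plane K" and ?F = "coord_plane (- K)"
  define G where "G y = (\<integral>\<^sup>+x. ennreal (f' (T *v (x + y))) \<partial>NE)" for y
  have perp: "T *v y \<in> ((*v) T ` ?E)\<^sup>\<bottom>" if "y \<in> ?F" for y
  proof -
    have "inner (T *v x) (T *v y) = 0" if "x \<in> ?E" for x
    proof -
      have "inner (T *v x) (T *v y) = inner ((T *v x) v* T) y" by (simp add: dot_lmul_matrix)
      also have "\<dots> = (\<Sum>i\<in>UNIV. x $ i * y $ i)" by (simp add: orthogonal_matrix_cancel[OF T] inner_vec_def)
      also have "\<dots> = 0"
        using that \<open>y \<in> ?F\<close> by (intro sum.neutral ballI) (auto simp: coord_plane_def)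
      finally show ?thesis .
    qed
    then show ?thesis by (auto simp: orthogonal_comp_def orthogonal_def)
  qed
  \<comment> \<open>The hypothesis parametrizes planes by vectors orthogonal to the rotated plane;
    the isometry \<open>T\<close> moves the parameter to the fixed plane \<open>?F\<close>, where
    the disintegration takes place.\<close>
  have "AE y in hausdorff_measure (card (- K)). T *v y \<in> ((*v) T ` ?E)\<^sup>\<bottom> \<longrightarrow>
        m \<le> (\<integral>\<^sup>+x\<in>(\<lambda>x. x + T *v y) ` ((*v) T ` coord_plane K). ennreal (f x) \<partial>hausdorff_measure (card K)) \<and>
        (\<integral>\<^sup>+x\<in>(\<lambda>x. x + T *v y) ` ((*v) T ` coord_plane K). ennreal (f x) \<partial>hausdorff_measure (card K)) \<le> M"
  proof (subst AE_hausdorff_isometry[where f="(*v) T"])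
    show "surj ((*v) T)" by (rule surjI[where f="\<lambda>x. x v* T"]) (rule orthogonal_matrix_cancel[OF T])
  qed (use orthogonal_matrix_dist[OF T] planes in simp_all)
  then have "AE y in NF. m \<le> (\<integral>\<^sup>+x\<in>(\<lambda>x. x + T *v y) ` ((*v) T ` coord_plane K). ennreal (f x) \<partial>hausdorff_measure (card K)) \<and>
        (\<integral>\<^sup>+x\<in>(\<lambda>x. x + T *v y) ` ((*v) T ` coord_plane K). ennreal (f x) \<partial>hausdorff_measure (card K)) \<le> M"
    unfolding NF_def AE_plane_measure[OF borel_coord_plane] by (rule eventually_mono) (use perp in blast)
  moreover note rotated_plane_integral[OF T f' ae, of K, folded NE_def NF_def]
  ultimately have G: "AE y in NF. m \<le> G y \<and> G y \<le> M"
    unfolding G_def by eventually_elim (simp only:)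
  have AE_E: "AE x in NE. x \<in> ?E" and AE_F: "AE y in NF. y \<in> ?F"
    unfolding NE_def NF_def by (simp_all add: AE_plane_measure)
  have cube_NF: "cube R \<in> sets NF" by (simp add: NF_def borel_subset_sets_hausdorff)
  have G_m: "(\<lambda>x. ennreal (f' (T *v (x + y)))) \<in> borel_measurable NE" for y
    unfolding NE_def by (intro measurable_plane_borel) measurable
  have "C * (\<integral>\<^sup>+x. ennreal (f' (T *v x)) * indicator (slab K R) x \<partial>lborel)
      = (\<integral>\<^sup>+y. \<integral>\<^sup>+x. ennreal (f' (T *v (x + y))) * indicator (slab K R) (x + y) \<partial>NE \<partial>NF)"
    by (rule C[symmetric]) measurable
  also have "\<dots> = (\<integral>\<^sup>+y. G y * indicator (cube R) y \<partial>NF)"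
  proof (rule nn_integral_cong_AE, rule eventually_mono[OF AE_F])
    fix y assume y: "y \<in> ?F"
    \<comment> \<open>On \<open>?F\<close> the coordinates in \<open>K\<close> vanish, and
      \<open>0 \<le> R\<close> makes them satisfy the cube condition, so slab and cube restrict the
      same coordinates.\<close>
    have "x + y \<in> slab K R \<longleftrightarrow> y \<in> cube R" if "x \<in> ?E" for x
    proof -
      have "\<bar>y $ i\<bar> \<le> R" if "i \<in> K" for i using y \<open>0 \<le> R\<close> that by (simp add: coord_plane_def)
      then show ?thesis using that by (auto simp: slab_def coord_plane_def)
    qed
    then have "(\<integral>\<^sup>+x. ennreal (f' (T *v (x + y))) * indicator (slab K R) (x + y) \<partial>NE)
        = (\<integral>\<^sup>+x. ennreal (f' (T *v (x + y))) * indicator (cube R) y \<partial>NE)"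
      by (intro nn_integral_cong_AE eventually_mono[OF AE_E]) (simp add: indicator_def)
    also have "\<dots> = G y * indicator (cube R) y"
      unfolding G_def by (rule nn_integral_multc[OF G_m])
    finally show "(\<integral>\<^sup>+x. ennreal (f' (T *v (x + y))) * indicator (slab K R) (x + y) \<partial>NE) = G y * indicator (cube R) y" .
  qed
  finally have eq: "C * (\<integral>\<^sup>+x. ennreal (f' (T *v x)) * indicator (slab K R) x \<partial>lborel)
      = (\<integral>\<^sup>+y. G y * indicator (cube R) y \<partial>NF)" .
  have "m * emeasure NF (cube R) = (\<integral>\<^sup>+y. m * indicator (cube R) y \<partial>NF)"
    using cube_NF by (simp add: nn_integral_cmult_indicator)
  also have "\<dots> \<le> (\<integral>\<^sup>+y. G y * indicator (cube R) y \<partial>NF)"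
    by (intro nn_integral_mono_AE eventually_mono[OF G] mult_right_mono) auto
  finally show "m * emeasure NF (cube R) \<le> C * (\<integral>\<^sup>+x. ennreal (f' (T *v x)) * indicator (slab K R) x \<partial>lborel)"
    by (simp only: eq)
  have "(\<integral>\<^sup>+y. G y * indicator (cube R) y \<partial>NF) \<le> (\<integral>\<^sup>+y. M * indicator (cube R) y \<partial>NF)"
    by (intro nn_integral_mono_AE eventually_mono[OF G] mult_right_mono) auto
  also have "\<dots> = M * emeasure NF (cube R)"
    using cube_NF by (simp add: nn_integral_cmult_indicator)
  finally show "C * (\<integral>\<^sup>+x. ennreal (f' (T *v x)) * indicator (slab K R) x \<partial>lborel) \<le> M * emeasure NF (cube R)"
    by (simp only: eq)
qed

theorem theorem1:
  fixes f :: "real ^ 'n \<Rightarrow> real"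
    and k :: nat
    and K :: "'n set"
    and \<mu> :: "(real ^ 'n ^ 'n) measure"
  assumes "CARD('n) \<ge> 2"
    and "1 \<le> k" and "k \<le> CARD('n) - 1"
    and "card K = k"
    and "orthogonal_haar \<mu>"
    and "f \<in> borel_measurable lebesgue"
    and "\<And>x. 0 \<le> f x"
  shows "\<not> (\<exists>m M :: real. 0 < m \<and> m \<le> M \<and>
            almost_all_affine_planes \<mu> K
              (\<lambda>P. ennreal m \<le> (\<integral>\<^sup>+x\<in>P. ennreal (f x) \<partial>hausdorff_measure k) \<and>
                   (\<integral>\<^sup>+x\<in>P. ennreal (f x) \<partial>hausdorff_measure k) \<le> ennreal M))"
proof (intro notI, elim exE conjE)
  fix m M :: real
  assume "0 < m"
    and planes: "almost_all_affine_planes \<mu> K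
              (\<lambda>P. ennreal m \<le> (\<integral>\<^sup>+x\<in>P. ennreal (f x) \<partial>hausdorff_measure k) \<and>
                   (\<integral>\<^sup>+x\<in>P. ennreal (f x) \<partial>hausdorff_measure k) \<le> ennreal M)"
  note haar = \<open>orthogonal_haar \<mu>\<close>
  let ?q = "card (- K)"
  define NF where "NF = plane_measure ?q (coord_plane (- K))"
  have q: "CARD('n) - card K = ?q" "0 < ?q"
    using card_Compl_finite[of K] assms(1-4) by auto
  have "K \<noteq> {}" using assms(2,4) by auto
  \<comment> \<open>The Borel version may be negative on a null set; \<open>ennreal\<close> sends
    such values to \<open>0\<close>.\<close>
  obtain f' where f' [measurable]: "f' \<in> borel_measurable borel" and ae: "AE x in lborel. f x = f' x"
    using completion_ex_borel_measurable_real[OF assms(6)] by auto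
  obtain C where C: "0 < C" "C < \<infinity>" "\<And>g :: real ^ 'n \<Rightarrow> ennreal. g \<in> borel_measurable borel \<Longrightarrow>
      (\<integral>\<^sup>+y. (\<integral>\<^sup>+x. g (x + y) \<partial>plane_measure (card K) (coord_plane K)) \<partial>NF) = C * (\<integral>\<^sup>+x. g x \<partial>lborel)"
    using lborel_coord_plane_disintegration[of K] unfolding NF_def by blast
  define I where "I R T = (\<integral>\<^sup>+x. ennreal (f' (T *v x)) * indicator (slab K R) x \<partial>lborel)" for R T
  define J where "J R = (\<integral>\<^sup>+x. ennreal (f' x) * ennreal (slab_prob \<mu> K R x) \<partial>lborel)" for R
  have J_eq: "J R = (\<integral>\<^sup>+T. I R T \<partial>\<mu>)" for R
    unfolding J_def I_def by (rule nn_integral_slab_prob[OF haar]) measurable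
  have C_cancel: "C * a / C = a" for a
    using C by (simp add: mult.commute[of C] ennreal_mult_divide_eq)
  have I_bounds: "AE T in \<mu>. ennreal m * emeasure NF (cube R) / C \<le> I R T \<and> I R T \<le> ennreal M * emeasure NF (cube R) / C"
    if "0 \<le> R" for R
  proof -
    have "AE T in \<mu>. orthogonal_matrix T"
      by (rule AE_I2) (simp add: orthogonal_haar_space[OF haar])
    with planes[unfolded almost_all_affine_planes_def q assms(4)[symmetric]] show ?thesis
    proof eventually_elim
      case (elim T)
      note bounds = rotated_slab_integral_bounds[OF elim(2) f' ae elim(1) C(3)[unfolded NF_def] that,
          folded NF_def I_def]
      show ?case
        using divide_right_mono_ennreal[OF bounds(1), of C] divide_right_mono_ennreal[OF bounds(2), of C]
        by (simp only: C_cancel)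
    qed
  qed
  have \<mu>_1: "emeasure \<mu> (space \<mu>) = 1" using haar by (simp add: orthogonal_haar_def)
  \<comment> \<open>\<open>\<mu>\<close> has total mass \<open>1\<close>, so bounds for almost every
    rotation pass unchanged to the average.\<close>
  have J_lower: "ennreal m * emeasure NF (cube R) / C \<le> J R" if "0 \<le> R" for R
    using nn_integral_mono_AE[of "\<lambda>_. ennreal m * emeasure NF (cube R) / C" "I R" \<mu>] I_bounds[OF that]
    by (simp add: J_eq \<mu>_1 eventually_mono)
  have J_upper: "J R \<le> ennreal M * emeasure NF (cube R) / C" if "0 \<le> R" for R
    using nn_integral_mono_AE[of "I R" "\<lambda>_. ennreal M * emeasure NF (cube R) / C" \<mu>] I_bounds[OF that]
    by (simp add: J_eq \<mu>_1 eventually_mono)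
  \<comment> \<open>The upper bound at radius \<open>1\<close> supplies the integrable
    majorant.\<close>
  have J_fin: "J 1 < \<infinity>"
  proof -
    have "ennreal M * emeasure NF (cube 1) / C < \<infinity>"
      using C cube_coord_plane_measure(2)[of 1 "- K"]
      by (auto simp: NF_def less_top[symmetric] ennreal_divide_eq_top_iff ennreal_mult_eq_top_iff)
    then show ?thesis using J_upper[of 1] by (auto intro: le_less_trans)
  qed
  obtain c where c: "C = ennreal c" "0 < c"
    using C by (cases C) auto
  \<comment> \<open>\<open>m\<close> times the constant from the lower estimate of
    \<open>emeasure NF (cube R)\<close>, divided by the disintegration constant.\<close>
  define \<epsilon> where "\<epsilon> = m * (unit_ball_vol (real ?q) / 2 ^ ?q) / c"
  have "\<epsilon> > 0" using \<open>0 < m\<close> c by (simp add: \<epsilon>_def)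
  have J_ge: "ennreal (\<epsilon> * R ^ ?q) \<le> J R" if "0 < R" for R
  proof -
    have "ennreal (\<epsilon> * R ^ ?q) = ennreal m * ennreal (unit_ball_vol (real ?q) / 2 ^ ?q * R ^ ?q) / C"
      using \<open>0 < m\<close> c that by (simp add: \<epsilon>_def divide_ennreal ennreal_mult[symmetric])
    also have "\<dots> \<le> ennreal m * emeasure NF (cube R) / C"
      unfolding NF_def by (intro divide_right_mono_ennreal mult_left_mono cube_coord_plane_measure that) auto
    also have "\<dots> \<le> J R" using that by (intro J_lower) simp
    finally show ?thesis .
  qed
  obtain D where D: "0 < D"
    "\<And>R x. 1 \<le> R \<Longrightarrow> x \<noteq> 0 \<Longrightarrow> slab_prob \<mu> K R x / R ^ ?q \<le> D * slab_prob \<mu> K 1 x"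
    by (rule slab_prob_dominated[OF haar \<open>K \<noteq> {}\<close>]) (rule that)
  \<comment> \<open>The radii \<open>Suc n\<close> start at \<open>1\<close>, where the domination
    estimate begins; the point \<open>0\<close>, which that estimate excludes, is a null
    set.\<close>
  define u where "u n x = ennreal (f' x) * ennreal (slab_prob \<mu> K (real (Suc n)) x / real (Suc n) ^ ?q)" for n x
  have sp_m [measurable]: "(\<lambda>x. slab_prob \<mu> K R x) \<in> borel_measurable borel" for R
    using borel_measurable_enn2real[OF slab_prob_measurable[OF haar, of K R]]
    by (simp add: slab_prob_nonneg[OF haar])
  have u_m [measurable]: "u n \<in> borel_measurable lborel" for n unfolding u_def by measurable
  have "(\<lambda>n. \<integral>\<^sup>+x. u n x \<partial>lborel) \<longlonglongrightarrow> (\<integral>\<^sup>+x. 0 \<partial>(lborel :: (real ^ 'n) measure))"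
  proof (rule nn_integral_dominated_convergence)
    show "AE x in lborel. u n x \<le> ennreal D * (ennreal (f' x) * ennreal (slab_prob \<mu> K 1 x))" for n
      using AE_lborel_singleton[of "0 :: real ^ 'n"]
    proof (rule eventually_mono)
      fix x :: "real ^ 'n" assume "x \<noteq> 0"
      then have "ennreal (slab_prob \<mu> K (real (Suc n)) x / real (Suc n) ^ ?q) \<le> ennreal D * ennreal (slab_prob \<mu> K 1 x)"
        using D(2)[of "real (Suc n)" x] D(1) by (simp add: ennreal_mult[symmetric] slab_prob_nonneg[OF haar] ennreal_leI)
      then show "u n x \<le> ennreal D * (ennreal (f' x) * ennreal (slab_prob \<mu> K 1 x))"
        unfolding u_def mult.left_commute[of "ennreal D"] by (rule mult_left_mono) simp
    qed
    have "(\<integral>\<^sup>+x. ennreal D * (ennreal (f' x) * ennreal (slab_prob \<mu> K 1 x)) \<partial>lborel) = ennreal D * J 1"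
      unfolding J_def by (rule nn_integral_cmult) measurable
    then show "(\<integral>\<^sup>+x. ennreal D * (ennreal (f' x) * ennreal (slab_prob \<mu> K 1 x)) \<partial>lborel) < \<infinity>"
      using J_fin by (simp add: ennreal_mult_less_top)
    show "AE x in lborel. (\<lambda>n. u n x) \<longlonglongrightarrow> 0"
    proof (rule AE_I2)
      fix x
      have "(\<lambda>n. slab_prob \<mu> K (real (Suc n)) x / real (Suc n) ^ ?q) \<longlonglongrightarrow> 0"
      \<comment> \<open>The probability is at most \<open>1\<close> and \<open>?q\<close> is at
        least \<open>1\<close>, so the quotient is at most the reciprocal of the radius.\<close>
      proof (rule tendsto_sandwich[OF _ _ tendsto_const LIMSEQ_inverse_real_of_nat])
        have "slab_prob \<mu> K (real (Suc n)) x / real (Suc n) ^ ?q \<le> inverse (real (Suc n))" for n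
        proof -
          have "real (Suc n) ^ 1 \<le> real (Suc n) ^ ?q" using q(2) by (intro power_increasing) auto
          then have "slab_prob \<mu> K (real (Suc n)) x / real (Suc n) ^ ?q \<le> 1 / real (Suc n) ^ 1"
            by (intro frac_le slab_prob_le_1[OF haar]) auto
          then show ?thesis by (simp add: divide_inverse)
        qed
        then show "\<forall>\<^sub>F n in sequentially. slab_prob \<mu> K (real (Suc n)) x / real (Suc n) ^ ?q \<le> inverse (real (Suc n))"
          by (intro always_eventually allI)
      qed (simp add: slab_prob_nonneg[OF haar])
      then have "(\<lambda>n. ennreal (max 0 (f' x) * (slab_prob \<mu> K (real (Suc n)) x / real (Suc n) ^ ?q))) \<longlonglongrightarrow> ennreal (max 0 (f' x) * 0)"
        by (intro tendsto_ennrealI tendsto_mult tendsto_const)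
      \<comment> \<open>Truncating \<open>f'\<close> at \<open>0\<close> leaves its
        \<open>ennreal\<close> value unchanged and allows the limit to be taken among nonnegative
        reals.\<close>
      moreover have "u n x = ennreal (max 0 (f' x) * (slab_prob \<mu> K (real (Suc n)) x / real (Suc n) ^ ?q))" for n
      proof -
        have "ennreal (f' x) = ennreal (max 0 (f' x))" by (simp add: max_def ennreal_neg)
        then show ?thesis
          unfolding u_def by (subst ennreal_mult) (simp_all add: slab_prob_nonneg[OF haar])
      qed
      ultimately show "(\<lambda>n. u n x) \<longlonglongrightarrow> 0" by simp
    qed
  qed measurable
  then have lim: "(\<lambda>n. \<integral>\<^sup>+x. u n x \<partial>lborel) \<longlonglongrightarrow> 0" by simp
  \<comment> \<open>Cancelling the power of the radius in \<open>J_ge\<close> gives a lower bound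
    independent of \<open>n\<close>, which the limit \<open>0\<close> contradicts.\<close>
  have "ennreal \<epsilon> \<le> (\<integral>\<^sup>+x. u n x \<partial>lborel)" for n
  proof -
    let ?r = "real (Suc n) ^ ?q"
    have r: "0 < ?r" by simp
    have "ennreal ?r * ennreal \<epsilon> \<le> J (real (Suc n))"
      using J_ge[of "real (Suc n)"] \<open>\<epsilon> > 0\<close> r by (simp add: ennreal_mult[symmetric] mult.commute)
    also have "\<dots> = (\<integral>\<^sup>+x. ennreal ?r * u n x \<partial>lborel)"
      unfolding J_def
    proof (rule nn_integral_cong)
      fix x
      have "ennreal (slab_prob \<mu> K (real (Suc n)) x) = ennreal (?r * (slab_prob \<mu> K (real (Suc n)) x / ?r))"
        using r by simp
      also have "\<dots> = ennreal ?r * ennreal (slab_prob \<mu> K (real (Suc n)) x / ?r)"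
        using r slab_prob_nonneg[OF haar] by (intro ennreal_mult) auto
      finally show "ennreal (f' x) * ennreal (slab_prob \<mu> K (real (Suc n)) x) = ennreal ?r * u n x"
        by (simp only: u_def mult.left_commute)
    qed
    also have "\<dots> = ennreal ?r * (\<integral>\<^sup>+x. u n x \<partial>lborel)" by (rule nn_integral_cmult) measurable
    finally show ?thesis
      using r by (subst (asm) ennreal_mult_le_mult_iff) auto
  qed
  then have "ennreal \<epsilon> \<le> 0"
    by (intro LIMSEQ_le_const[OF lim]) auto
  then show False using \<open>\<epsilon> > 0\<close> by (simp add: ennreal_eq_0_iff)
qed

end
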